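(* For any self-similar action $(G,E)$, the tight groupoid $\mathcal G(G,E)$ is effective if and only if $(G,E)$ satisfies (Cyc) and (Slack), and there is no $g\in G\setminus G^0$ such that $s(g)$ is an infinite receiver and $g$ fixes all paths in $s(g)E^*$ except for those that are extensions of elements in some finite set $F\subseteq s(g)E^1$.
   Context: An étale groupoid $\mathcal G$ with unit space $X$ is effective if the interior of $\{\gamma\in\mathcal G:r(\gamma)=s(\gamma)\}$ in $\mathcal G$ equals $X$. A directed graph $E=(E^0,E^1,r,s)$ has vertices $E^0$, edges $E^1$, and maps $r,s:E^1\to E^0$. For $n\ge1$, $E^n$ is the set of paths $\mu=\mu_1\cdots\mu_n$ ($\mu_i\in E^1$, $s(\mu_i)=r(\mu_{i+1})$), $r(\mu)=r(\mu_1)$, $s(\mu)=s(\mu_n)$, $|\mu|=n$; vertices are paths of length $0$ with $r(v)=s(v)=v$; $E^*=\bigcup_{n\ge0}E^n$; $E^\infty$ is the set of infinite paths; $vE^n,vE^*$ denote paths with range $v$. $\alpha$ extends $\beta$ ($\beta$ is a prefix of $\alpha$) if $\alpha=\beta\beta'$; paths are comparable if one extends the other. A vertex $v$ is an infinite receiver if $vE^1$ is infinite, and singular if $vE^1$ is empty or infinite. A path $\alpha=\alpha_1\cdots\alpha_n$ has an entrance if one of $r(\alpha_1),\dots,r(\alpha_n),s(\alpha_n)$ is the range of two distinct edges. $(G,E)$ is a self-similar action if $G$ is a discrete groupoid with $G^0=E^0$, equipped with a left action $(g,e)\mapsto ge$ on $E^1$ (defined when $s(g)=r(e)$, with $r(ge)=r(g)$,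 $(hg)e=h(ge)$, $r(e)e=e$) and a map $(g,e)\mapsto g|_e\in G$ with $(hg)|_e=h|_{ge}\,g|_e$, $s(g|_e)=s(e)$, $r(g|_e)=s(ge)$. It extends to paths by $g\,s(g)=r(g)$, $g|_{s(g)}=g$, $g(e\mu)=(ge)(g|_e\mu)$, $g|_{e\mu}=(g|_e)|_\mu$, and to infinite paths by $g(\mu_1\mu_2\cdots)=(g\mu_1)(g|_{\mu_1}\mu_2)(g|_{\mu_1\mu_2}\mu_3)\cdots$. $g$ fixes $\mu$ if $g\mu=\mu$; $\mu\in s(g)E^*$ is strongly $g$-fixed if $g\mu=\mu$ and $g|_\mu=s(\mu)$. (Cyc): for every $g\in G$, every path $\alpha\in E^*\setminus E^0$ with $s(\alpha)=s(g)$ and $r(\alpha)=r(g)$ has an entrance. (Slack): if $g\in G$ fixes every path in $s(g)E^*$, then $g$ has slack, i.e. there is a finite set $F\subseteq s(g)E^*$ of strongly $g$-fixed paths such that every path in $s(g)E^*$ is comparable with a path in $F$. "$g$ fixes all paths except those that are extensions of elements in $F$" means that $g$ fixes every path in $s(g)E^*$ that does not extend an element of $F$. $E^{\le\infty}=E^*\cup E^\infty$; $Z(\alpha)$ is the set of elements of $E^{\le\infty}$ with prefix $\alpha$; the sets $Z(\alpha)\setminus\bigcup_{\beta\in F}Z(\alpha\beta)$ ($F\subseteq s(\alpha)E^*$ finite) form a basis of the topology. $\partial E=E^\infty\cup\{\mu\in E^*:s(\mu)\text{ singular}\}$. $\mathcal G(G,E)$ consists of classes $[\alpha,g,\beta;\xi]$,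 where $\alpha,\beta\in E^*$, $g\in G$, $r(g)=s(\alpha)$, $s(g)=s(\beta)$, $\xi\in Z(\beta)\cap\partial E$, and $[\alpha,g,\beta;\xi]=[\gamma,h,\delta;\eta]$ iff $\xi=\eta$ and there are $\beta',\delta'\in E^*$ with $\beta\beta'=\delta\delta'$ a prefix of $\xi$, $\alpha(g\beta')=\gamma(h\delta')$ and $g|_{\beta'}=h|_{\delta'}$. The source of $[\alpha,g,\beta;\beta\xi]$ is $\beta\xi$, its range is $\alpha(g\xi)$; products are $[s;\xi][t;\eta]=[st;\eta]$ (when composable), where $(\alpha,g,\beta)(\gamma,h,\delta)=(\alpha(g\beta'),g|_{\beta'}h,\delta)$ if $\gamma=\beta\beta'$ and $=(\alpha,g(h^{-1}|_{\gamma'})^{-1},\delta(h^{-1}\gamma'))$ if $\beta=\gamma\gamma'$; $\xi\in\partial E$ is identified with the unit $[r(\xi),r(\xi),r(\xi);\xi]$, so the unit space is $\partial E$; basic open sets are $\{[\alpha,g,\beta;\xi]:\xi\in V\}$, $V\subseteq Z(\beta)\cap\partial E$ open. *)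

theory Defs
  imports
    "HOL-Analysis.Abstract_Topology"
    "HOL-Library.Stream"
    "Graph_Theory.Digraph"
begin

section \<open>Groupoids\<close>

text \<open>
  Units are themselves arrows, and range and source take values in the units.
  The product \<open>gmult G g h\<close> is meaningful if \<open>src G g = rng G h\<close>.
\<close>

record 'g groupoid =
  arrows :: "'g set"
  units :: "'g set"
  rng :: "'g \<Rightarrow> 'g"
  src :: "'g \<Rightarrow> 'g"
  gmult :: "'g \<Rightarrow> 'g \<Rightarrow> 'g"

locale groupoid =
  fixes G :: "('g, 'z) groupoid_scheme" (structure)
  assumes units_arrows: "units G \<subseteq> arrows G"
    and rng_units: "g \<in> arrows G \<Longrightarrow> rng G g \<in> units G"
    and src_units: "g \<in> arrows G \<Longrightarrow> src G g \<in> units G"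
    and rng_unit: "u \<in> units G \<Longrightarrow> rng G u = u"
    and src_unit: "u \<in> units G \<Longrightarrow> src G u = u"
    and mult_arrows: "\<lbrakk>g \<in> arrows G; h \<in> arrows G; src G g = rng G h\<rbrakk>
      \<Longrightarrow> gmult G g h \<in> arrows G"
    and rng_mult: "\<lbrakk>g \<in> arrows G; h \<in> arrows G; src G g = rng G h\<rbrakk>
      \<Longrightarrow> rng G (gmult G g h) = rng G g"
    and src_mult: "\<lbrakk>g \<in> arrows G; h \<in> arrows G; src G g = rng G h\<rbrakk>
      \<Longrightarrow> src G (gmult G g h) = src G h"
    and mult_assoc: "\<lbrakk>g \<in> arrows G; h \<in> arrows G; k \<in> arrows G;
        src G g = rng G h; src G h = rng G k\<rbrakk>
      \<Longrightarrow> gmult G (gmult G g h) k = gmult G g (gmult G h k)"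
    and rng_mult_left: "g \<in> arrows G \<Longrightarrow> gmult G (rng G g) g = g"
    and src_mult_right: "g \<in> arrows G \<Longrightarrow> gmult G g (src G g) = g"
    and inverse_ex: "g \<in> arrows G \<Longrightarrow>
      \<exists>h\<in>arrows G. rng G h = src G g \<and> src G h = rng G g \<and>
        gmult G g h = rng G g \<and> gmult G h g = src G g"

definition ginv :: "('g, 'z) groupoid_scheme \<Rightarrow> 'g \<Rightarrow> 'g" where
  "ginv G g = (THE h. h \<in> arrows G \<and> rng G h = src G g \<and> src G h = rng G g \<and>
     gmult G g h = rng G g \<and> gmult G h g = src G g)"

record 'g top_groupoid = "'g groupoid" +
  arrow_topology :: "'g topology"

definition effective :: "('g, 'z) top_groupoid_scheme \<Rightarrow> bool" where
  "effective \<G> \<longleftrightarrow>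
     arrow_topology \<G> interior_of {\<gamma> \<in> arrows \<G>. rng \<G> \<gamma> = src \<G> \<gamma>} = units \<G>"


section \<open>Directed graphs and their path spaces\<close>

text \<open>
  For an edge \<open>e\<close> of the graph \<open>E\<close>, the range \<open>r(e)\<close> is \<open>head E e\<close> and the source
  \<open>s(e)\<close> is \<open>tail E e\<close>. A finite path is a pair \<open>(v, [\<mu>\<^sub>1, \<dots>, \<mu>\<^sub>n])\<close> with \<open>v\<close> the range
  of the path; in particular \<open>(v, [])\<close> is the vertex \<open>v\<close>, regarded as a path of length 0.
  Edges are composed from left to right by \<open>s(\<mu>\<^sub>i) = r(\<mu>\<^sub>i\<^sub>+\<^sub>1)\<close>, which is the opposite of
  the order of the walks in the theory of digraphs.
\<close>

type_synonym ('v, 'e) fpath = "'v \<times> 'e list"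

definition fpaths :: "('v, 'e) pre_digraph \<Rightarrow> ('v, 'e) fpath set" where
  "fpaths E = {(v, es). v \<in> verts E \<and> set es \<subseteq> arcs E \<and>
     (es \<noteq> [] \<longrightarrow> head E (hd es) = v) \<and> successively (\<lambda>e f. tail E e = head E f) es}"

definition prange :: "('v, 'e) fpath \<Rightarrow> 'v" where
  "prange \<mu> = fst \<mu>"

definition psource :: "('v, 'e) pre_digraph \<Rightarrow> ('v, 'e) fpath \<Rightarrow> 'v" where
  "psource E \<mu> = (if snd \<mu> = [] then fst \<mu> else tail E (last (snd \<mu>)))"

definition plength :: "('v, 'e) fpath \<Rightarrow> nat" where
  "plength \<mu> = length (snd \<mu>)"

definition fpaths_at :: "('v, 'e) pre_digraph \<Rightarrow> 'v \<Rightarrow> ('v, 'e) fpath set" where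
  "fpaths_at E v = {\<mu> \<in> fpaths E. prange \<mu> = v}"

definition pconcat :: "('v, 'e) fpath \<Rightarrow> ('v, 'e) fpath \<Rightarrow> ('v, 'e) fpath" where
  "pconcat \<mu> \<nu> = (fst \<mu>, snd \<mu> @ snd \<nu>)"

definition extends :: "('v, 'e) pre_digraph \<Rightarrow> ('v, 'e) fpath \<Rightarrow> ('v, 'e) fpath \<Rightarrow> bool" where
  "extends E \<alpha> \<beta> \<longleftrightarrow> (\<exists>\<beta>'\<in>fpaths_at E (psource E \<beta>). \<alpha> = pconcat \<beta> \<beta>')"

definition comparable :: "('v, 'e) pre_digraph \<Rightarrow> ('v, 'e) fpath \<Rightarrow> ('v, 'e) fpath \<Rightarrow> bool" where
  "comparable E \<alpha> \<beta> \<longleftrightarrow> extends E \<alpha> \<beta> \<or> extends E \<beta> \<alpha>"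

definition infinite_receiver :: "('v, 'e) pre_digraph \<Rightarrow> 'v \<Rightarrow> bool" where
  "infinite_receiver E v \<longleftrightarrow> infinite (in_arcs E v)"

definition singular :: "('v, 'e) pre_digraph \<Rightarrow> 'v \<Rightarrow> bool" where
  "singular E v \<longleftrightarrow> in_arcs E v = {} \<or> infinite (in_arcs E v)"

definition has_entrance :: "('v, 'e) pre_digraph \<Rightarrow> ('v, 'e) fpath \<Rightarrow> bool" where
  "has_entrance E \<alpha> \<longleftrightarrow> (\<exists>w \<in> head E ` set (snd \<alpha>) \<union> {psource E \<alpha>}.
     \<exists>e\<in>in_arcs E w. \<exists>f\<in>in_arcs E w. e \<noteq> f)"

datatype ('v, 'e) xpath = FinPath "('v, 'e) fpath" | InfPath "'e stream"

definition inf_paths :: "('v, 'e) pre_digraph \<Rightarrow> 'e stream set" where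
  "inf_paths E = {x. \<forall>n. x !! n \<in> arcs E \<and> tail E (x !! n) = head E (x !! Suc n)}"

text \<open>The set \<open>E\<^sup>\<le>\<^sup>\<infinity>\<close> of all finite and infinite paths.\<close>

definition xpaths :: "('v, 'e) pre_digraph \<Rightarrow> ('v, 'e) xpath set" where
  "xpaths E = FinPath ` fpaths E \<union> InfPath ` inf_paths E"

primrec xrange :: "('v, 'e) pre_digraph \<Rightarrow> ('v, 'e) xpath \<Rightarrow> 'v" where
  "xrange E (FinPath \<mu>) = prange \<mu>"
| "xrange E (InfPath x) = head E (shd x)"

primrec xconcat :: "('v, 'e) fpath \<Rightarrow> ('v, 'e) xpath \<Rightarrow> ('v, 'e) xpath" where
  "xconcat \<alpha> (FinPath \<mu>) = FinPath (pconcat \<alpha> \<mu>)"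
| "xconcat \<alpha> (InfPath x) = InfPath (snd \<alpha> @- x)"

definition xpaths_at :: "('v, 'e) pre_digraph \<Rightarrow> 'v \<Rightarrow> ('v, 'e) xpath set" where
  "xpaths_at E v = {\<xi> \<in> xpaths E. xrange E \<xi> = v}"

definition cylinder :: "('v, 'e) pre_digraph \<Rightarrow> ('v, 'e) fpath \<Rightarrow> ('v, 'e) xpath set" where
  "cylinder E \<alpha> = xconcat \<alpha> ` xpaths_at E (psource E \<alpha>)"

text \<open>The path \<open>\<xi>'\<close> with \<open>\<xi> = \<beta>\<xi>'\<close>, for \<open>\<xi>\<close> in the cylinder of \<open>\<beta>\<close>.\<close>

definition xremainder ::
    "('v, 'e) pre_digraph \<Rightarrow> ('v, 'e) fpath \<Rightarrow> ('v, 'e) xpath \<Rightarrow> ('v, 'e) xpath" where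
  "xremainder E \<beta> \<xi> = (THE \<xi>'. \<xi>' \<in> xpaths_at E (psource E \<beta>) \<and> \<xi> = xconcat \<beta> \<xi>')"

definition premainder ::
    "('v, 'e) pre_digraph \<Rightarrow> ('v, 'e) fpath \<Rightarrow> ('v, 'e) fpath \<Rightarrow> ('v, 'e) fpath" where
  "premainder E \<beta> \<gamma> = (THE \<beta>'. \<beta>' \<in> fpaths_at E (psource E \<beta>) \<and> \<gamma> = pconcat \<beta> \<beta>')"

definition path_topology :: "('v, 'e) pre_digraph \<Rightarrow> ('v, 'e) xpath topology" where
  "path_topology E = topology_generated_by
     {cylinder E \<alpha> - (\<Union>\<beta>\<in>F. cylinder E (pconcat \<alpha> \<beta>)) | \<alpha> F.
        \<alpha> \<in> fpaths E \<and> finite F \<and> F \<subseteq> fpaths_at E (psource E \<alpha>)}"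

definition boundary_paths :: "('v, 'e) pre_digraph \<Rightarrow> ('v, 'e) xpath set" where
  "boundary_paths E = InfPath ` inf_paths E \<union> FinPath ` {\<mu> \<in> fpaths E. singular E (psource E \<mu>)}"

definition boundary_topology :: "('v, 'e) pre_digraph \<Rightarrow> ('v, 'e) xpath topology" where
  "boundary_topology E = subtopology (path_topology E) (boundary_paths E)"


section \<open>Self-similar actions\<close>

text \<open>
  \<open>act A g e\<close> is the edge \<open>ge\<close> and \<open>res A g e\<close> is the restriction \<open>g|\<^sub>e\<close>; both are
  meaningful if \<open>s(g) = r(e)\<close>. The vertices of the graph are the units of the groupoid.
\<close>

record ('g, 'e) ssa =
  grp :: "'g groupoid"
  gra :: "('g, 'e) pre_digraph"
  act :: "'g \<Rightarrow> 'e \<Rightarrow> 'e"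
  res :: "'g \<Rightarrow> 'e \<Rightarrow> 'g"

locale self_similar_action =
  groupoid "grp A" + wf_digraph "gra A"
  for A :: "('g, 'e) ssa" +
  assumes units_verts: "units (grp A) = verts (gra A)"
    and act_arcs: "\<lbrakk>g \<in> arrows (grp A); e \<in> arcs (gra A); src (grp A) g = head (gra A) e\<rbrakk>
      \<Longrightarrow> act A g e \<in> arcs (gra A)"
    and head_act: "\<lbrakk>g \<in> arrows (grp A); e \<in> arcs (gra A); src (grp A) g = head (gra A) e\<rbrakk>
      \<Longrightarrow> head (gra A) (act A g e) = rng (grp A) g"
    and act_mult: "\<lbrakk>g \<in> arrows (grp A); h \<in> arrows (grp A); e \<in> arcs (gra A);
        src (grp A) h = rng (grp A) g; src (grp A) g = head (gra A) e\<rbrakk>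
      \<Longrightarrow> act A (gmult (grp A) h g) e = act A h (act A g e)"
    and act_unit: "e \<in> arcs (gra A) \<Longrightarrow> act A (head (gra A) e) e = e"
    and res_arrows: "\<lbrakk>g \<in> arrows (grp A); e \<in> arcs (gra A); src (grp A) g = head (gra A) e\<rbrakk>
      \<Longrightarrow> res A g e \<in> arrows (grp A)"
    and res_mult: "\<lbrakk>g \<in> arrows (grp A); h \<in> arrows (grp A); e \<in> arcs (gra A);
        src (grp A) h = rng (grp A) g; src (grp A) g = head (gra A) e\<rbrakk>
      \<Longrightarrow> res A (gmult (grp A) h g) e = gmult (grp A) (res A h (act A g e)) (res A g e)"
    and src_res: "\<lbrakk>g \<in> arrows (grp A); e \<in> arcs (gra A); src (grp A) g = head (gra A) e\<rbrakk>
      \<Longrightarrow> src (grp A) (res A g e) = tail (gra A) e"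
    and rng_res: "\<lbrakk>g \<in> arrows (grp A); e \<in> arcs (gra A); src (grp A) g = head (gra A) e\<rbrakk>
      \<Longrightarrow> rng (grp A) (res A g e) = tail (gra A) (act A g e)"

primrec act_edges :: "('g, 'e) ssa \<Rightarrow> 'g \<Rightarrow> 'e list \<Rightarrow> 'e list" where
  "act_edges A g [] = []"
| "act_edges A g (e # es) = act A g e # act_edges A (res A g e) es"

definition act_path :: "('g, 'e) ssa \<Rightarrow> 'g \<Rightarrow> ('g, 'e) fpath \<Rightarrow> ('g, 'e) fpath" where
  "act_path A g \<mu> = (rng (grp A) g, act_edges A g (snd \<mu>))"

primrec res_edges :: "('g, 'e) ssa \<Rightarrow> 'g \<Rightarrow> 'e list \<Rightarrow> 'g" where
  "res_edges A g [] = g"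
| "res_edges A g (e # es) = res_edges A (res A g e) es"

definition res_path :: "('g, 'e) ssa \<Rightarrow> 'g \<Rightarrow> ('g, 'e) fpath \<Rightarrow> 'g" where
  "res_path A g \<mu> = res_edges A g (snd \<mu>)"

primcorec act_stream :: "('g, 'e) ssa \<Rightarrow> 'g \<Rightarrow> 'e stream \<Rightarrow> 'e stream" where
  "act_stream A g x = act A g (shd x) ## act_stream A (res A g (shd x)) (stl x)"

primrec act_xpath :: "('g, 'e) ssa \<Rightarrow> 'g \<Rightarrow> ('g, 'e) xpath \<Rightarrow> ('g, 'e) xpath" where
  "act_xpath A g (FinPath \<mu>) = FinPath (act_path A g \<mu>)"
| "act_xpath A g (InfPath x) = InfPath (act_stream A g x)"

definition fixes_path :: "('g, 'e) ssa \<Rightarrow> 'g \<Rightarrow> ('g, 'e) fpath \<Rightarrow> bool" where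
  "fixes_path A g \<mu> \<longleftrightarrow> act_path A g \<mu> = \<mu>"

definition strongly_fixed :: "('g, 'e) ssa \<Rightarrow> 'g \<Rightarrow> ('g, 'e) fpath set" where
  "strongly_fixed A g = {\<mu> \<in> fpaths_at (gra A) (src (grp A) g).
     fixes_path A g \<mu> \<and> res_path A g \<mu> = psource (gra A) \<mu>}"

definition has_slack :: "('g, 'e) ssa \<Rightarrow> 'g \<Rightarrow> bool" where
  "has_slack A g \<longleftrightarrow> (\<exists>F. finite F \<and> F \<subseteq> strongly_fixed A g \<and>
     (\<forall>\<mu>\<in>fpaths_at (gra A) (src (grp A) g). \<exists>\<nu>\<in>F. comparable (gra A) \<mu> \<nu>))"

definition cond_Cyc :: "('g, 'e) ssa \<Rightarrow> bool" where
  "cond_Cyc A \<longleftrightarrow> (\<forall>g\<in>arrows (grp A). \<forall>\<alpha>\<in>fpaths (gra A).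
     plength \<alpha> \<ge> 1 \<and> psource (gra A) \<alpha> = src (grp A) g \<and> prange \<alpha> = rng (grp A) g
       \<longrightarrow> has_entrance (gra A) \<alpha>)"

definition cond_Slack :: "('g, 'e) ssa \<Rightarrow> bool" where
  "cond_Slack A \<longleftrightarrow> (\<forall>g\<in>arrows (grp A).
     (\<forall>\<mu>\<in>fpaths_at (gra A) (src (grp A) g). fixes_path A g \<mu>) \<longrightarrow> has_slack A g)"

definition fixes_all_except :: "('g, 'e) ssa \<Rightarrow> 'g \<Rightarrow> ('g, 'e) fpath set \<Rightarrow> bool" where
  "fixes_all_except A g F \<longleftrightarrow> (\<forall>\<mu>\<in>fpaths_at (gra A) (src (grp A) g).
     (\<forall>\<beta>\<in>F. \<not> extends (gra A) \<mu> \<beta>) \<longrightarrow> fixes_path A g \<mu>)"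


section \<open>The tight groupoid\<close>

text \<open>A quadruple \<open>(\<alpha>, g, \<beta>, \<xi>)\<close> represents the germ \<open>[\<alpha>, g, \<beta>; \<xi>]\<close>.\<close>

type_synonym ('g, 'e) quad =
  "('g, 'e) fpath \<times> 'g \<times> ('g, 'e) fpath \<times> ('g, 'e) xpath"

definition quads :: "('g, 'e) ssa \<Rightarrow> ('g, 'e) quad set" where
  "quads A = {(\<alpha>, g, \<beta>, \<xi>). \<alpha> \<in> fpaths (gra A) \<and> g \<in> arrows (grp A) \<and> \<beta> \<in> fpaths (gra A) \<and>
     rng (grp A) g = psource (gra A) \<alpha> \<and> src (grp A) g = psource (gra A) \<beta> \<and>
     \<xi> \<in> cylinder (gra A) \<beta> \<inter> boundary_paths (gra A)}"

definition germ_rel :: "('g, 'e) ssa \<Rightarrow> (('g, 'e) quad \<times> ('g, 'e) quad) set" where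
  "germ_rel A = {((\<alpha>, g, \<beta>, \<xi>), (\<gamma>, h, \<delta>, \<eta>)).
     (\<alpha>, g, \<beta>, \<xi>) \<in> quads A \<and> (\<gamma>, h, \<delta>, \<eta>) \<in> quads A \<and> \<xi> = \<eta> \<and>
     (\<exists>\<beta>'\<in>fpaths_at (gra A) (psource (gra A) \<beta>). \<exists>\<delta>'\<in>fpaths_at (gra A) (psource (gra A) \<delta>).
        pconcat \<beta> \<beta>' = pconcat \<delta> \<delta>' \<and> \<xi> \<in> cylinder (gra A) (pconcat \<beta> \<beta>') \<and>
        pconcat \<alpha> (act_path A g \<beta>') = pconcat \<gamma> (act_path A h \<delta>') \<and>
        res_path A g \<beta>' = res_path A h \<delta>')}"

definition germ :: "('g, 'e) ssa \<Rightarrow> ('g, 'e) quad \<Rightarrow> ('g, 'e) quad set" where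
  "germ A q = germ_rel A `` {q}"

definition unit_germ :: "('g, 'e) ssa \<Rightarrow> ('g, 'e) xpath \<Rightarrow> ('g, 'e) quad set" where
  "unit_germ A \<xi> = (let v = xrange (gra A) \<xi> in germ A ((v, []), v, (v, []), \<xi>))"

fun quad_range :: "('g, 'e) ssa \<Rightarrow> ('g, 'e) quad \<Rightarrow> ('g, 'e) xpath" where
  "quad_range A (\<alpha>, g, \<beta>, \<xi>) = xconcat \<alpha> (act_xpath A g (xremainder (gra A) \<beta> \<xi>))"

fun quad_source :: "('g, 'e) ssa \<Rightarrow> ('g, 'e) quad \<Rightarrow> ('g, 'e) xpath" where
  "quad_source A (\<alpha>, g, \<beta>, \<xi>) = \<xi>"

text \<open>
  The product \<open>[\<alpha>, g, \<beta>; \<xi>][\<gamma>, h, \<delta>; \<eta>]\<close>. If the germs are composable, then \<open>\<beta>\<close> and \<open>\<gamma>\<close> are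
  both prefixes of \<open>\<xi>\<close>, so that one of them extends the other.
\<close>

fun quad_mult :: "('g, 'e) ssa \<Rightarrow> ('g, 'e) quad \<Rightarrow> ('g, 'e) quad \<Rightarrow> ('g, 'e) quad" where
  "quad_mult A (\<alpha>, g, \<beta>, \<xi>) (\<gamma>, h, \<delta>, \<eta>) =
     (if extends (gra A) \<gamma> \<beta> then
        let \<beta>' = premainder (gra A) \<beta> \<gamma>
        in (pconcat \<alpha> (act_path A g \<beta>'), gmult (grp A) (res_path A g \<beta>') h, \<delta>, \<eta>)
      else
        let \<gamma>' = premainder (gra A) \<gamma> \<beta>; k = ginv (grp A) h
        in (\<alpha>, gmult (grp A) g (ginv (grp A) (res_path A k \<gamma>')),
            pconcat \<delta> (act_path A k \<gamma>'), \<eta>))"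

text \<open>
  Range, source and product do not depend on the choice of representatives, so the images
  below are singletons. The boundary path \<open>\<xi>\<close> is identified with the unit \<open>unit_germ A \<xi>\<close>.
\<close>

definition tight_groupoid :: "('g, 'e) ssa \<Rightarrow> ('g, 'e) quad set top_groupoid" where
  "tight_groupoid A =
     \<lparr>arrows = quads A // germ_rel A,
      units = unit_germ A ` boundary_paths (gra A),
      rng = (\<lambda>\<Gamma>. the_elem ((\<lambda>q. unit_germ A (quad_range A q)) ` \<Gamma>)),
      src = (\<lambda>\<Gamma>. the_elem ((\<lambda>q. unit_germ A (quad_source A q)) ` \<Gamma>)),
      gmult = (\<lambda>\<Gamma> \<Delta>. the_elem ((\<lambda>(p, q). germ A (quad_mult A p q)) ` (\<Gamma> \<times> \<Delta>))),
      arrow_topology = topology_generated_by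
        {(\<lambda>\<xi>. germ A (\<alpha>, g, \<beta>, \<xi>)) ` V | \<alpha> g \<beta> V.
           \<alpha> \<in> fpaths (gra A) \<and> g \<in> arrows (grp A) \<and> \<beta> \<in> fpaths (gra A) \<and>
           rng (grp A) g = psource (gra A) \<alpha> \<and> src (grp A) g = psource (gra A) \<beta> \<and>
           openin (boundary_topology (gra A)) V \<and> V \<subseteq> cylinder (gra A) \<beta>}\<rparr>"

end

theory Submission
  imports Defs
begin

text \<open>
  An arrow \<open>[\<alpha>, g, \<beta>; \<xi>]\<close> lies in the interior of the isotropy iff \<open>\<alpha>(g\<eta>) = \<beta>\<eta>\<close> for all
  \<open>\<beta>\<eta>\<close> in a neighbourhood of \<open>\<xi>\<close>, and it is a unit iff \<open>\<alpha> = \<beta>\<close> after passing to a longer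
  \<open>\<beta>\<close>, with \<open>g\<close> becoming a vertex. If \<open>\<xi>\<close> is infinite, one may lengthen \<open>\<beta>\<close> until the
  neighbourhood is the whole cylinder of \<open>\<beta>\<close>. If then \<open>|\<alpha>| \<noteq> |\<beta>|\<close>, the longer path is the shorter one
  followed by a path \<open>\<gamma>\<close> that every boundary path in \<open>r(\<gamma>)\<close> must extend; so \<open>\<gamma>\<close> has no entrance,
  against (Cyc). Hence \<open>\<alpha> = \<beta>\<close> and \<open>g\<close> fixes all paths, and (Slack) makes the arrow a unit. If
  \<open>\<xi>\<close> is finite, one may take \<open>\<beta> = \<xi>\<close>, which forces \<open>\<alpha> = \<beta>\<close>; the neighbourhood excludes finitely
  many edges, and the last condition (or (Slack), if \<open>s(\<xi>)\<close> receives no edge) says that \<open>g\<close> is a unit.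
  Conversely, a failure of one of the three conditions yields an open set of isotropic arrows
  that are not all units; for (Slack), the finite set is found by Koenig's lemma.
\<close>

section \<open>Truncations of paths, cylinders, and the boundary of the path space\<close>

section \<open>Path spaces\<close>

text \<open>Induction on how the open set is generated, with the point \<open>x\<close> fixed: in a
  union only the member containing \<open>x\<close> matters, and \<open>mono\<close> does the rest.
  With \<open>N\<close> read as "contains a neighbourhood of \<open>x\<close> of the desired shape",
  it reduces such claims to the generating sets.\<close>

lemma openin_generated_nhd:
  assumes "openin (topology_generated_by B) U" "x \<in> U"
    and base: "\<And>S. S \<in> B \<Longrightarrow> x \<in> S \<Longrightarrow> N S"
    and inter: "\<And>S T. N S \<Longrightarrow> N T \<Longrightarrow> N (S \<inter> T)"
    and mono: "\<And>S T. N S \<Longrightarrow> S \<subseteq> T \<Longrightarrow> N T"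
  shows "N U"
proof -
  have "generate_topology_on B U"
    using assms(1) by (simp add: openin_topology_generated_by_iff)
  then show ?thesis
    using \<open>x \<in> U\<close>
  proof induction
    case (UN K)
    then show ?case by (meson Union_upper UnionE mono)
  qed (auto intro: base inter)
qed

text \<open>The dependent-choice half of Koenig's lemma. It yields boundary paths in
  \<open>boundary_extension\<close> and the bad infinite path in
  \<open>effective_imp_slack\<close>.\<close>

lemma stream_of_extendable_lists:
  assumes "P []" and step: "\<And>es. P es \<Longrightarrow> \<exists>e. P (es @ [e])"
  shows "\<exists>x. \<forall>n. P (stake n x)"
proof -
  have "\<exists>f. \<forall>n::nat. (P (f n) \<and> length (f n) = n) \<and> (\<exists>e. f (Suc n) = f n @ [e])"
  proof (rule dependent_nat_choice)
    fix es n assume "P es \<and> length es = n"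
    then show "\<exists>fs. (P fs \<and> length fs = Suc n) \<and> (\<exists>e. fs = es @ [e])"
      using step [of es] by auto
  qed (use assms in auto)
  then obtain f where f: "P (f n)" "length (f n) = n" "\<exists>e. f (Suc n) = f n @ [e]" for n
    by auto
  \<comment> \<open>The n-th edge is the one added in passing from \<open>f n\<close> to
    \<open>f (Suc n)\<close>.\<close>
  define x where "x = smap (\<lambda>n. last (f (Suc n))) nats"
  have x: "x !! n = last (f (Suc n))" for n
    by (simp add: x_def)
  have "stake n x = f n" for n
  proof (induction n)
    case 0
    show ?case using f(2) [of 0] by simp
  next
    case (Suc n)
    obtain e where "f (Suc n) = f n @ [e]" using f(3) by blast
    then show ?case by (simp add: stake_Suc Suc.IH x del: stake.simps(2))
  qed
  then show ?thesis using f(1) by metis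
qed

text \<open>A finite path with fewer than n edges is returned whole. Truncations reduce statements
  about finite and infinite paths alike to edge lists.\<close>

primrec xtake :: "nat \<Rightarrow> ('v, 'e) xpath \<Rightarrow> 'e list" where
  "xtake n (FinPath \<mu>) = take n (snd \<mu>)"
| "xtake n (InfPath x) = stake n x"

lemma take_xtake: "k \<le> n \<Longrightarrow> take k (xtake n \<xi>) = xtake k \<xi>"
  by (cases \<xi>) (auto simp: take_stake min_def)

lemma length_xtake_le: "length (xtake n \<xi>) \<le> n"
  by (cases \<xi>) auto

lemma xtake_length_xtake [simp]: "xtake (length (xtake n \<xi>)) \<xi> = xtake n \<xi>"
  by (cases \<xi>) (auto simp: min_def)

lemma xtake_xconcat:
  "xtake n (xconcat \<alpha> \<xi>) = take n (snd \<alpha>) @ xtake (n - length (snd \<alpha>)) \<xi>"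
  by (cases \<xi>) (auto simp: pconcat_def stake_shift)

text \<open>The lengths \<open>a\<close> and \<open>b\<close> may differ, as happens when ranges of
  germs are compared; cutting both truncations to \<open>m\<close> edges removes the difference. The
  range is compared separately because an empty edge list does not remember its vertex.\<close>

lemma xpath_eqI:
  assumes "xrange E \<xi> = xrange E \<eta>" and "\<And>m. \<exists>a\<ge>m. \<exists>b\<ge>m. xtake a \<xi> = xtake b \<eta>"
  shows "\<xi> = \<eta>"
proof -
  have eq: "xtake m \<xi> = xtake m \<eta>" for m
    using assms(2) [of m] take_xtake by metis
  show ?thesis
  proof (cases \<xi>)
    case (FinPath \<mu>)
    show ?thesis
    proof (cases \<eta>)
      case (FinPath \<nu>)
      have "snd \<mu> = snd \<nu>"
        using eq [of "max (length (snd \<mu>)) (length (snd \<nu>))"] FinPath \<open>\<xi> = FinPath \<mu>\<close> by simp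
      then show ?thesis
        using assms(1) FinPath \<open>\<xi> = FinPath \<mu>\<close> by (simp add: prange_def prod_eq_iff)
    next
      case (InfPath y)
      \<comment> \<open>One edge beyond the end of the finite path the truncations have different
        lengths.\<close>
      show ?thesis
        using arg_cong [OF eq [of "Suc (length (snd \<mu>))"], of length] InfPath FinPath by simp
    qed
  next
    case (InfPath x)
    show ?thesis
    proof (cases \<eta>)
      case (FinPath \<nu>)
      show ?thesis
        using arg_cong [OF eq [of "Suc (length (snd \<nu>))"], of length] InfPath FinPath by simp
    next
      case (InfPath y)
      have "x !! n = y !! n" for n
        using eq [of "Suc n"] InfPath \<open>\<xi> = InfPath x\<close> by (simp add: stake_Suc del: stake.simps(2))
      then show ?thesis
        using InfPath \<open>\<xi> = InfPath x\<close> by (metis (no_types, lifting) stream_smap_nats stream.map_cong0)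
    qed
  qed
qed

context wf_digraph
begin

lemma fpaths_Nil [simp]: "(v, []) \<in> fpaths G \<longleftrightarrow> v \<in> verts G"
  by (simp add: fpaths_def)

lemma fpaths_Cons [simp]:
  "(v, e # es) \<in> fpaths G \<longleftrightarrow> e \<in> arcs G \<and> head G e = v \<and> (tail G e, es) \<in> fpaths G"
  by (cases es) (auto simp: fpaths_def)

lemma psource_Nil [simp]: "psource G (v, []) = v"
  by (simp add: psource_def)

lemma psource_Cons [simp]: "psource G (v, e # es) = psource G (tail G e, es)"
  by (simp add: psource_def)

lemma psource_append [simp]: "psource G (v, es @ fs) = psource G (psource G (v, es), fs)"
  by (simp add: psource_def)

lemma fpaths_append [simp]:
  "(v, es @ fs) \<in> fpaths G \<longleftrightarrow> (v, es) \<in> fpaths G \<and> (psource G (v, es), fs) \<in> fpaths G"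
proof (induction es arbitrary: v)
  case Nil
  then show ?case by (cases fs) auto
qed auto

lemma fpaths_verts: "(v, es) \<in> fpaths G \<Longrightarrow> v \<in> verts G"
  by (cases es) auto

lemma psource_verts: "\<alpha> \<in> fpaths G \<Longrightarrow> psource G \<alpha> \<in> verts G"
  by (cases \<alpha>) (metis append_Nil2 fpaths_Nil fpaths_append)

lemma fpaths_at_iff: "\<mu> \<in> fpaths_at G v \<longleftrightarrow> (\<exists>es. \<mu> = (v, es) \<and> (v, es) \<in> fpaths G)"
  by (cases \<mu>) (auto simp: fpaths_at_def prange_def)

lemma bex_fpaths_at: "(\<exists>\<mu>\<in>fpaths_at G v. P \<mu>) \<longleftrightarrow> (\<exists>es. (v, es) \<in> fpaths G \<and> P (v, es))"
  by (auto simp: fpaths_at_iff)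

lemma extends_iff:
  "(v, es) \<in> fpaths G \<Longrightarrow> extends G (v, es) (w, fs) \<longleftrightarrow> v = w \<and> (\<exists>gs. es = fs @ gs)"
  by (auto simp: extends_def bex_fpaths_at pconcat_def)

text \<open>Adjacency of the edges n and n + 1 is visible in the initial segment with n + 2 edges.
  This is the form that \<open>stream_of_extendable_lists\<close> delivers.\<close>

lemma inf_paths_iff: "x \<in> inf_paths G \<longleftrightarrow> (\<forall>n. (head G (shd x), stake n x) \<in> fpaths G)"
proof
  assume "x \<in> inf_paths G"
  then have x: "x !! n \<in> arcs G" "tail G (x !! n) = head G (x !! Suc n)" for n
    by (auto simp: inf_paths_def)
  have "(head G (x !! k), stake n (sdrop k x)) \<in> fpaths G" for n k
  proof (induction n arbitrary: k)
    case (Suc n)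
    show ?case using Suc [of "Suc k"] x [of k] by simp
  qed (simp add: x)
  from this [of 0] show "\<forall>n. (head G (shd x), stake n x) \<in> fpaths G"
    by simp
next
  assume *: "\<forall>n. (head G (shd x), stake n x) \<in> fpaths G"
  have "x !! n \<in> arcs G \<and> tail G (x !! n) = head G (x !! Suc n)" for n
    using spec [OF *, of "Suc (Suc n)"] by (simp add: stake_Suc del: stake.simps(2))
  then show "x \<in> inf_paths G"
    by (simp add: inf_paths_def)
qed

lemma xtake_fpaths:
  assumes "\<xi> \<in> xpaths G"
  shows "(xrange G \<xi>, xtake n \<xi>) \<in> fpaths G"
proof (cases \<xi>)
  case (FinPath \<mu>)
  then have "(fst \<mu>, take n (snd \<mu>) @ drop n (snd \<mu>)) \<in> fpaths G"
    using assms by (auto simp: xpaths_def)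
  then show ?thesis
    using FinPath unfolding fpaths_append by (simp add: prange_def)
next
  case (InfPath x)
  then show ?thesis using assms by (auto simp: xpaths_def inf_paths_iff)
qed

lemma xpathsI:
  assumes "\<And>n. (xrange G \<xi>, xtake n \<xi>) \<in> fpaths G"
  shows "\<xi> \<in> xpaths G"
proof (cases \<xi>)
  case (FinPath \<mu>)
  then show ?thesis
    using assms [of "length (snd \<mu>)"] by (auto simp: xpaths_def prange_def)
next
  case (InfPath x)
  then show ?thesis using assms by (auto simp: xpaths_def inf_paths_iff)
qed

lemma xrange_xconcat:
  assumes "\<alpha> \<in> fpaths G" "\<xi> \<in> xpaths_at G (psource G \<alpha>)"
  shows "xrange G (xconcat \<alpha> \<xi>) = fst \<alpha>"
  using assms
  by (cases \<alpha>; cases \<xi>; cases "snd \<alpha>")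
    (auto simp: pconcat_def prange_def xpaths_at_def)

lemma xconcat_xpaths:
  assumes "\<alpha> \<in> fpaths G" "\<xi> \<in> xpaths_at G (psource G \<alpha>)"
  shows "xconcat \<alpha> \<xi> \<in> xpaths G"
proof (rule xpathsI)
  fix n
  obtain v es where \<alpha>: "\<alpha> = (v, es)" by force
  have 1: "(v, take n es @ drop n es) \<in> fpaths G" using assms \<alpha> by simp
  have 2: "n \<ge> length es \<Longrightarrow> (psource G (v, es), xtake (n - length es) \<xi>) \<in> fpaths G"
    using assms xtake_fpaths [of \<xi>] \<alpha> by (auto simp: xpaths_at_def)
  have "(v, take n es @ xtake (n - length es) \<xi>) \<in> fpaths G"
  proof (cases "n \<ge> length es")
    case True
    then show ?thesis using 2 assms \<alpha> by simp
  next
    case False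
    then have "xtake (n - length es) \<xi> = []" by (cases \<xi>) auto
    then show ?thesis using 1 unfolding fpaths_append by (auto simp: psource_verts)
  qed
  then show "(xrange G (xconcat \<alpha> \<xi>), xtake n (xconcat \<alpha> \<xi>)) \<in> fpaths G"
    using xrange_xconcat [OF assms] by (simp add: xtake_xconcat \<alpha>)
qed

text \<open>Splitting \<xi> after \<open>length es\<close> edges recovers the remainder, so a
  truncation replaces the existentially quantified continuation in the definition.\<close>

lemma cylinder_iff:
  assumes "(v, es) \<in> fpaths G"
  shows "\<xi> \<in> cylinder G (v, es) \<longleftrightarrow>
    \<xi> \<in> xpaths G \<and> xrange G \<xi> = v \<and> xtake (length es) \<xi> = es"
proof
  assume "\<xi> \<in> cylinder G (v, es)"
  then obtain \<eta> where \<eta>: "\<eta> \<in> xpaths_at G (psource G (v, es))" "\<xi> = xconcat (v, es) \<eta>"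
    by (auto simp: cylinder_def)
  have "xtake 0 \<eta> = []" by (cases \<eta>) auto
  then show "\<xi> \<in> xpaths G \<and> xrange G \<xi> = v \<and> xtake (length es) \<xi> = es"
    using xrange_xconcat [OF assms \<eta>(1)] xconcat_xpaths [OF assms \<eta>(1)] \<eta>(2)
    by (simp add: xtake_xconcat)
next
  assume *: "\<xi> \<in> xpaths G \<and> xrange G \<xi> = v \<and> xtake (length es) \<xi> = es"
  show "\<xi> \<in> cylinder G (v, es)"
  proof (cases \<xi>)
    case (FinPath \<mu>)
    define fs where "fs = drop (length es) (snd \<mu>)"
    have \<mu>: "\<mu> = (v, es @ fs)"
      using * FinPath unfolding fs_def
      by (metis append_take_drop_id prange_def prod.collapse xrange.simps(1) xtake.simps(1))
    then have "(psource G (v, es), fs) \<in> fpaths G"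
      using * FinPath by (auto simp: xpaths_def)
    then show ?thesis
      unfolding cylinder_def FinPath \<mu>
      by (intro image_eqI [where x = "FinPath (psource G (v, es), fs)"])
        (auto simp: pconcat_def xpaths_at_def xpaths_def prange_def)
  next
    case (InfPath x)
    define y where "y = sdrop (length es) x"
    have x: "x = es @- y"
      using * InfPath unfolding y_def by (metis stake_sdrop xtake.simps(2))
    have st: "(psource G (v, es), stake n y) \<in> fpaths G" for n
      using xtake_fpaths [of \<xi> "length es + n"] * InfPath x by (simp add: stake_shift)
    \<comment> \<open>The single edge \<open>stake 1 y\<close> already shows where \<open>y\<close>
      starts, which \<open>inf_paths_iff\<close> requires.\<close>
    from st [of 1] have hd: "head G (shd y) = psource G (v, es)" by simp
    then have "y \<in> inf_paths G" using st by (simp add: inf_paths_iff)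
    then show ?thesis
      unfolding cylinder_def InfPath x
      by (intro image_eqI [where x = "InfPath y"]) (auto simp: xpaths_at_def xpaths_def hd)
  qed
qed

text \<open>Left cancellation: the truncations of \<beta>\<xi> past the length of \<beta> determine
  those of \<xi>.\<close>

lemma xremainder_xconcat:
  assumes "\<xi> \<in> xpaths_at G (psource G \<beta>)"
  shows "xremainder G \<beta> (xconcat \<beta> \<xi>) = \<xi>"
  unfolding xremainder_def
proof (rule the_equality)
  fix \<eta>
  assume *: "\<eta> \<in> xpaths_at G (psource G \<beta>) \<and> xconcat \<beta> \<xi> = xconcat \<beta> \<eta>"
  have "xtake (length (snd \<beta>) + m) (xconcat \<beta> \<zeta>) = snd \<beta> @ xtake m \<zeta>" for m \<zeta>
    by (simp add: xtake_xconcat)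
  then have "xtake m \<eta> = xtake m \<xi>" for m
    using * by (metis same_append_eq)
  then show "\<eta> = \<xi>"
    using * assms by (intro xpath_eqI [of G]) (auto simp: xpaths_at_def)
qed (use assms in simp)

lemma boundary_paths_xpaths: "boundary_paths G \<subseteq> xpaths G"
  by (auto simp: boundary_paths_def xpaths_def)

text \<open>Prepending \<alpha> neither makes a finite path infinite nor changes its source, and
  these alone decide whether a path lies in the boundary.\<close>

lemma xconcat_boundary_iff:
  assumes "\<alpha> \<in> fpaths G" "\<xi> \<in> xpaths_at G (psource G \<alpha>)"
  shows "xconcat \<alpha> \<xi> \<in> boundary_paths G \<longleftrightarrow> \<xi> \<in> boundary_paths G"
proof -
  have "xconcat \<alpha> \<xi> \<in> xpaths G" "\<xi> \<in> xpaths G"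
    using xconcat_xpaths [OF assms] assms(2) by (auto simp: xpaths_at_def)
  then show ?thesis
    using assms by (cases \<alpha>; cases \<xi>) (auto simp: boundary_paths_def xpaths_def pconcat_def
      xpaths_at_def prange_def)
qed

text \<open>Either some continuation ends at a singular vertex, or every continuation can be
  prolonged by an edge and a limit stream exists. Equations between boundary paths thereby yield
  equations between finite paths.\<close>

lemma boundary_extension:
  assumes "(v, es) \<in> fpaths G"
  shows "\<exists>\<xi> \<in> boundary_paths G. \<xi> \<in> cylinder G (v, es)"
proof -
  let ?w = "psource G (v, es)"
  have "\<exists>\<eta> \<in> boundary_paths G. xrange G \<eta> = ?w"
  proof (cases "\<exists>fs. (?w, fs) \<in> fpaths G \<and> singular G (psource G (?w, fs))")
    case True
    then show ?thesis
      by (auto simp: boundary_paths_def prange_def intro!: bexI [of _ "FinPath (?w, _)"])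
  next
    case False
    have "\<exists>x. \<forall>n. (?w, stake n x) \<in> fpaths G"
    proof (rule stream_of_extendable_lists)
      show "(?w, []) \<in> fpaths G" using psource_verts [OF assms] by simp
    next
      fix fs assume fs: "(?w, fs) \<in> fpaths G"
      then have "in_arcs G (psource G (?w, fs)) \<noteq> {}"
        using False by (auto simp: singular_def)
      then show "\<exists>e. (?w, fs @ [e]) \<in> fpaths G"
        using fs by (auto simp: in_arcs_def)
    qed
    then obtain x where x: "\<And>n. (?w, stake n x) \<in> fpaths G" by blast
    from x [of 1] have "head G (shd x) = ?w" by simp
    then show ?thesis
      using x by (auto simp: boundary_paths_def inf_paths_iff intro!: bexI [of _ "InfPath x"])
  qed
  then obtain \<eta> where \<eta>: "\<eta> \<in> boundary_paths G" "xrange G \<eta> = ?w" by blast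
  then have "\<eta> \<in> xpaths_at G ?w"
    using boundary_paths_xpaths by (auto simp: xpaths_at_def)
  then show ?thesis
    using assms \<eta> xconcat_boundary_iff by (auto simp: cylinder_def)
qed

end


section \<open>Action of units, inverses and general arrows on finite paths and boundary
  paths\<close>

section \<open>The action on paths\<close>

lemma act_edges_append [simp]:
  "act_edges A g (es @ fs) = act_edges A g es @ act_edges A (res_edges A g es) fs"
  by (induction es arbitrary: g) auto

lemma res_edges_append [simp]:
  "res_edges A g (es @ fs) = res_edges A (res_edges A g es) fs"
  by (induction es arbitrary: g) auto

lemma length_act_edges [simp]: "length (act_edges A g es) = length es"
  by (induction es arbitrary: g) auto

text \<open>The first n edges of the image depend only on the first n edges. This reduces the action
  on finite and infinite paths alike to \<open>act_edges\<close>.\<close>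

lemma xtake_act_xpath: "xtake n (act_xpath A g \<xi>) = act_edges A g (xtake n \<xi>)"
proof (cases \<xi>)
  case (FinPath \<mu>)
  have "take n (act_edges A g es) = act_edges A g (take n es)" for es
    by (induction es arbitrary: g n) (auto simp: take_Cons split: nat.split)
  then show ?thesis using FinPath by (simp add: act_path_def)
next
  case (InfPath x)
  have "stake n (act_stream A g x) = act_edges A g (stake n x)"
    by (induction n arbitrary: g x) auto
  then show ?thesis using InfPath by simp
qed

context self_similar_action
begin

abbreviation "E \<equiv> gra A"

lemma act_edges_closed:
  assumes "g \<in> arrows (grp A)" "(src (grp A) g, es) \<in> fpaths E"
  shows act_edges_fpaths: "(rng (grp A) g, act_edges A g es) \<in> fpaths E"
    and res_edges_arrows: "res_edges A g es \<in> arrows (grp A)"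
    and src_res_edges: "src (grp A) (res_edges A g es) = psource E (src (grp A) g, es)"
    and rng_res_edges:
      "rng (grp A) (res_edges A g es) = psource E (rng (grp A) g, act_edges A g es)"
proof -
  have "(rng (grp A) g, act_edges A g es) \<in> fpaths E \<and> res_edges A g es \<in> arrows (grp A) \<and>
    src (grp A) (res_edges A g es) = psource E (src (grp A) g, es) \<and>
    rng (grp A) (res_edges A g es) = psource E (rng (grp A) g, act_edges A g es)"
    using assms
  proof (induction es arbitrary: g)
    case Nil
    then show ?case using rng_units units_verts by auto
  next
    case (Cons e es)
    then have "e \<in> arcs E" "head E e = src (grp A) g" by auto
    then show ?case
      using Cons Cons.IH [of "res A g e"]
      by (simp add: act_arcs head_act res_arrows src_res rng_res)
  qed
  then show "(rng (grp A) g, act_edges A g es) \<in> fpaths E" "res_edges A g es \<in> arrows (grp A)"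
    "src (grp A) (res_edges A g es) = psource E (src (grp A) g, es)"
    "rng (grp A) (res_edges A g es) = psource E (rng (grp A) g, act_edges A g es)"
    by auto
qed

lemma act_edges_mult:
  assumes "g \<in> arrows (grp A)" "h \<in> arrows (grp A)" "src (grp A) h = rng (grp A) g"
    "(src (grp A) g, es) \<in> fpaths E"
  shows "act_edges A (gmult (grp A) h g) es = act_edges A h (act_edges A g es)"
  using assms
proof (induction es arbitrary: g h)
  case (Cons e es)
  then have "e \<in> arcs E" "src (grp A) g = head E e" by auto
  then show ?case
    using Cons.prems Cons.IH [of "res A g e" "res A h (act A g e)"]
    by (simp add: act_mult res_mult act_arcs head_act res_arrows src_res rng_res)
qed simp

text \<open>Cancel one factor of xx = x with an inverse of x.\<close>

lemma idempotent_unit: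
  assumes x: "x \<in> arrows (grp A)" "src (grp A) x = rng (grp A) x" "gmult (grp A) x x = x"
  shows "x = src (grp A) x"
proof -
  obtain y where y: "y \<in> arrows (grp A)" "src (grp A) y = rng (grp A) x"
    "gmult (grp A) y x = src (grp A) x"
    using inverse_ex [OF x(1)] by blast
  have "gmult (grp A) (gmult (grp A) y x) x = gmult (grp A) y x"
    using mult_assoc [OF y(1) x(1) x(1)] x y by simp
  then show ?thesis
    using rng_mult_left [OF x(1)] x y by simp
qed

text \<open>The axioms say how a vertex v acts on an edge, but its restriction has to be computed: v
  = vv makes \<open>res A v e\<close> idempotent by \<open>res_mult\<close>, hence a vertex by
  \<open>idempotent_unit\<close>.\<close>

lemma act_edges_unit:
  assumes "(v, es) \<in> fpaths E"
  shows act_edges_unit_fixes: "act_edges A v es = es"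
    and res_edges_unit: "res_edges A v es = psource E (v, es)"
proof -
  have res: "res A (head E e) e = tail E e" if e: "e \<in> arcs E" for e
  proof -
    let ?v = "head E e"
    have v: "?v \<in> units (grp A)" using e head_in_verts units_verts by simp
    then have va: "?v \<in> arrows (grp A)" using units_arrows by blast
    have vs: "src (grp A) ?v = ?v" "rng (grp A) ?v = ?v"
      using v src_unit rng_unit by auto
    have vv: "gmult (grp A) ?v ?v = ?v" using rng_mult_left [OF va] vs by simp
    have x: "res A ?v e \<in> arrows (grp A)" "src (grp A) (res A ?v e) = tail E e"
      "rng (grp A) (res A ?v e) = tail E e"
      using res_arrows src_res rng_res act_unit va vs e by auto
    have "gmult (grp A) (res A ?v e) (res A ?v e) = res A ?v e"
      using res_mult [OF va va e] vs vv act_unit [OF e] by simp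
    then show ?thesis using idempotent_unit x by metis
  qed
  have "act_edges A v es = es \<and> res_edges A v es = psource E (v, es)"
    using assms by (induction es arbitrary: v) (auto simp: act_unit res)
  then show "act_edges A v es = es" "res_edges A v es = psource E (v, es)" by auto
qed

text \<open>An arrow and its inverse multiply to vertices, and vertices act trivially by
  \<open>act_edges_unit\<close>.\<close>

lemma inverse_action:
  assumes g: "g \<in> arrows (grp A)"
  obtains h where "h \<in> arrows (grp A)" "src (grp A) h = rng (grp A) g"
    "rng (grp A) h = src (grp A) g"
    "\<And>es. (src (grp A) g, es) \<in> fpaths E \<Longrightarrow> act_edges A h (act_edges A g es) = es"
    "\<And>es. (rng (grp A) g, es) \<in> fpaths E \<Longrightarrow> act_edges A g (act_edges A h es) = es"
proof -
  obtain h where h: "h \<in> arrows (grp A)" "src (grp A) h = rng (grp A) g"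
    "rng (grp A) h = src (grp A) g" "gmult (grp A) g h = rng (grp A) g"
    "gmult (grp A) h g = src (grp A) g"
    using inverse_ex [OF g] by blast
  show ?thesis
  proof (rule that [OF h(1-3)])
    show "act_edges A h (act_edges A g es) = es" if "(src (grp A) g, es) \<in> fpaths E" for es
      using act_edges_mult [OF g h(1)] act_edges_unit_fixes that h by metis
    show "act_edges A g (act_edges A h es) = es" if "(rng (grp A) g, es) \<in> fpaths E" for es
      using act_edges_mult [OF h(1) g] act_edges_unit_fixes that h by metis
  qed
qed

lemma bij_betw_act:
  assumes g: "g \<in> arrows (grp A)"
  shows "bij_betw (act A g) (in_arcs E (src (grp A) g)) (in_arcs E (rng (grp A) g))"
proof -
  obtain h where h: "h \<in> arrows (grp A)" "src (grp A) h = rng (grp A) g"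
    "rng (grp A) h = src (grp A) g"
    "\<And>es. (src (grp A) g, es) \<in> fpaths E \<Longrightarrow> act_edges A h (act_edges A g es) = es"
    "\<And>es. (rng (grp A) g, es) \<in> fpaths E \<Longrightarrow> act_edges A g (act_edges A h es) = es"
    using inverse_action [OF g] by metis
  show ?thesis
  proof (rule bij_betw_byWitness [where f' = "act A h"])
    show "\<forall>e\<in>in_arcs E (src (grp A) g). act A h (act A g e) = e"
      using h(4) [of "[_]"] by (auto simp: tail_in_verts)
    show "\<forall>e\<in>in_arcs E (rng (grp A) g). act A g (act A h e) = e"
      using h(5) [of "[_]"] by (auto simp: tail_in_verts)
  qed (use g h act_arcs head_act in auto)
qed

text \<open>The action of g is a bijection between the edges received by s(g) and those received by
  r(g), so emptiness and finiteness agree.\<close>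

lemma singular_act:
  assumes "g \<in> arrows (grp A)"
  shows "singular E (rng (grp A) g) \<longleftrightarrow> singular E (src (grp A) g)"
  using bij_betw_finite [OF bij_betw_act [OF assms]] bij_betw_empty1 bij_betw_empty2
    bij_betw_act [OF assms]
  unfolding singular_def by metis

lemma act_xpath_at:
  assumes g: "g \<in> arrows (grp A)" and \<xi>: "\<xi> \<in> xpaths_at E (src (grp A) g)"
  shows "act_xpath A g \<xi> \<in> xpaths_at E (rng (grp A) g)"
proof -
  have fp: "(src (grp A) g, xtake n \<xi>) \<in> fpaths E" for n
    using \<xi> xtake_fpaths [of \<xi>] by (auto simp: xpaths_at_def)
  have "xrange E (act_xpath A g \<xi>) = rng (grp A) g"
  proof (cases \<xi>)
    case (InfPath x)
    then show ?thesis using fp [of 1] head_act g by simp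
  qed (simp add: act_path_def prange_def)
  moreover have "act_xpath A g \<xi> \<in> xpaths E"
    by (rule xpathsI) (use fp act_edges_fpaths [OF g] calculation in \<open>simp add: xtake_act_xpath\<close>)
  ultimately show ?thesis by (simp add: xpaths_at_def)
qed

text \<open>If \<xi> is finite, the restriction of g to \<xi> is an arrow from the end of \<xi> to
  the end of its image, and \<open>singular_act\<close> compares these two vertices.\<close>

lemma act_xpath_boundary:
  assumes g: "g \<in> arrows (grp A)" and \<xi>: "\<xi> \<in> xpaths_at E (src (grp A) g)"
    and bd: "\<xi> \<in> boundary_paths E"
  shows "act_xpath A g \<xi> \<in> boundary_paths E"
proof (cases \<xi>)
  case (FinPath \<mu>)
  define es where "es = snd \<mu>"
  have \<mu>: "\<mu> = (src (grp A) g, es)"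
    using FinPath \<xi> by (auto simp: es_def xpaths_at_def prange_def prod_eq_iff)
  have fp: "(src (grp A) g, es) \<in> fpaths E" and s: "singular E (psource E (src (grp A) g, es))"
    using bd FinPath \<mu> by (auto simp: boundary_paths_def)
  have "singular E (psource E (rng (grp A) g, act_edges A g es))"
    using singular_act [OF res_edges_arrows [OF g fp]] s src_res_edges [OF g fp]
      rng_res_edges [OF g fp] by simp
  then show ?thesis
    using act_edges_fpaths [OF g fp] FinPath \<mu> by (auto simp: boundary_paths_def act_path_def)
next
  case (InfPath x)
  then show ?thesis
    using act_xpath_at [OF g \<xi>] by (auto simp: boundary_paths_def xpaths_at_def xpaths_def)
qed

text \<open>The preimage is the image under an inverse of g, checked truncation by
  truncation.\<close>

lemma act_xpath_surj:
  assumes g: "g \<in> arrows (grp A)" and \<eta>: "\<eta> \<in> xpaths_at E (rng (grp A) g)"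
    and bd: "\<eta> \<in> boundary_paths E"
  shows "\<exists>\<xi>. \<xi> \<in> xpaths_at E (src (grp A) g) \<and> \<xi> \<in> boundary_paths E \<and> act_xpath A g \<xi> = \<eta>"
proof -
  obtain h where h: "h \<in> arrows (grp A)" "src (grp A) h = rng (grp A) g"
    "rng (grp A) h = src (grp A) g"
    "\<And>es. (rng (grp A) g, es) \<in> fpaths E \<Longrightarrow> act_edges A g (act_edges A h es) = es"
    using inverse_action [OF g] by metis
  let ?\<xi> = "act_xpath A h \<eta>"
  have \<xi>: "?\<xi> \<in> xpaths_at E (src (grp A) g)" "?\<xi> \<in> boundary_paths E"
    using act_xpath_at [OF h(1)] act_xpath_boundary [OF h(1)] h \<eta> bd by auto
  have "act_xpath A g ?\<xi> = \<eta>"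
  proof (rule xpath_eqI)
    show "xrange E (act_xpath A g ?\<xi>) = xrange E \<eta>"
      using act_xpath_at [OF g \<xi>(1)] \<eta> by (simp add: xpaths_at_def)
    have "(rng (grp A) g, xtake n \<eta>) \<in> fpaths E" for n
      using xtake_fpaths [of \<eta>] \<eta> by (auto simp: xpaths_at_def)
    then have "xtake n (act_xpath A g ?\<xi>) = xtake n \<eta>" for n
      using h(4) by (simp add: xtake_act_xpath)
    then show "\<exists>a\<ge>m. \<exists>b\<ge>m. xtake a (act_xpath A g ?\<xi>) = xtake b \<eta>" for m
      by blast
  qed
  then show ?thesis using \<xi> by blast
qed

end


section \<open>Germ equality as eventual equality along truncations\<close>

section \<open>Germs\<close>

text \<open>With \<beta>\<beta>' the first n edges of \<xi>, this is the pair of \<alpha>(g\<beta>')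
  and the restriction of g to \<beta>'. It is meant for n at least the length of \<beta>; for
  smaller n, \<open>drop\<close> returns the empty list.\<close>

definition germ_data :: "('g, 'e) ssa \<Rightarrow> nat \<Rightarrow> ('g, 'e) quad \<Rightarrow> ('g, 'e) fpath \<times> 'g" where
  "germ_data A n = (\<lambda>(\<alpha>, g, \<beta>, \<xi>). let es = drop (length (snd \<beta>)) (xtake n \<xi>)
     in ((fst \<alpha>, snd \<alpha> @ act_edges A g es), res_edges A g es))"

context self_similar_action
begin

lemma quad_cases:
  assumes "(\<alpha>, g, \<beta>, \<xi>) \<in> quads A"
  obtains as b bs where "\<alpha> = (fst \<alpha>, as)" "\<beta> = (b, bs)" "(fst \<alpha>, as) \<in> fpaths E"
    "(b, bs) \<in> fpaths E" "g \<in> arrows (grp A)" "rng (grp A) g = psource E (fst \<alpha>, as)"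
    "src (grp A) g = psource E (b, bs)" "\<xi> \<in> boundary_paths E" "\<xi> \<in> xpaths E"
    "xrange E \<xi> = b" "xtake (length bs) \<xi> = bs"
  using assms cylinder_iff [of "fst \<beta>" "snd \<beta>" \<xi>]
  by (cases \<alpha>; cases \<beta>) (auto simp: quads_def)

lemma drop_xtake:
  assumes "(b, bs) \<in> fpaths E" "\<xi> \<in> cylinder E (b, bs)" "length bs \<le> n"
  shows "xtake n \<xi> = bs @ drop (length bs) (xtake n \<xi>)"
  using assms take_xtake [of "length bs" n \<xi>] append_take_drop_id [of "length bs" "xtake n \<xi>"]
  by (simp add: cylinder_iff)

text \<open>Agreement along one common prefix persists for longer truncations of \<xi>, since equal
  restrictions act on the same further edges. Conversely, a truncation past \<beta> and \<delta>
  supplies the common prefix.\<close>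

lemma germ_rel_iff:
  "(p, q) \<in> germ_rel A \<longleftrightarrow> p \<in> quads A \<and> q \<in> quads A \<and> quad_source A p = quad_source A q \<and>
     (\<exists>N. \<forall>n\<ge>N. germ_data A n p = germ_data A n q)"
proof -
  obtain a as g b bs \<xi> where p: "p = ((a, as), g, (b, bs), \<xi>)" by (metis surj_pair)
  obtain c cs h d ds \<eta> where q: "q = ((c, cs), h, (d, ds), \<eta>)" by (metis surj_pair)
  show ?thesis
  proof (cases "p \<in> quads A \<and> q \<in> quads A \<and> \<xi> = \<eta>")
    case True
    then have P: "(b, bs) \<in> fpaths E" "\<xi> \<in> xpaths E" "xrange E \<xi> = b" "xtake (length bs) \<xi> = bs"
      and Q: "(d, ds) \<in> fpaths E" "d = b" "xtake (length ds) \<xi> = ds"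
      using p q by (auto elim!: quad_cases)
    show ?thesis
    proof
      assume "(p, q) \<in> germ_rel A"
      then obtain bs' ds' where fp: "(b, bs @ bs') \<in> fpaths E" and eq: "bs @ bs' = ds @ ds'"
        and cyl: "\<xi> \<in> cylinder E (b, bs @ bs')"
        and E: "a = c" "as @ act_edges A g bs' = cs @ act_edges A h ds'"
          "res_edges A g bs' = res_edges A h ds'"
        using P Q
        by (auto simp: p q germ_rel_def bex_fpaths_at pconcat_def act_path_def res_path_def)
      have "germ_data A n p = germ_data A n q" if n: "n \<ge> length (bs @ bs')" for n
      proof -
        obtain ts where ts: "xtake n \<xi> = (bs @ bs') @ ts"
          using drop_xtake [OF fp cyl n] by blast
        have "drop (length bs) (xtake n \<xi>) = bs' @ ts"
          unfolding ts by simp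
        moreover have "drop (length ds) (xtake n \<xi>) = ds' @ ts"
          unfolding ts eq by simp
        ultimately show ?thesis
          using True E by (simp add: p q germ_data_def)
      qed
      then show "p \<in> quads A \<and> q \<in> quads A \<and> quad_source A p = quad_source A q \<and>
          (\<exists>N. \<forall>n\<ge>N. germ_data A n p = germ_data A n q)"
        using True by (auto simp: p q)
    next
      assume "p \<in> quads A \<and> q \<in> quads A \<and> quad_source A p = quad_source A q \<and>
        (\<exists>N. \<forall>n\<ge>N. germ_data A n p = germ_data A n q)"
      then obtain N where N: "\<And>n. n \<ge> N \<Longrightarrow> germ_data A n p = germ_data A n q" by blast
      \<comment> \<open>Late enough for the eventual equality and past the ends of both \<beta> and
        \<delta>.\<close>
      define n where "n = N + length bs + length ds"
      define bs' ds' where "bs' = drop (length bs) (xtake n \<xi>)"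
        and "ds' = drop (length ds) (xtake n \<xi>)"
      have bs: "xtake n \<xi> = bs @ bs'" and ds: "xtake n \<xi> = ds @ ds'"
        using P Q drop_xtake [of b bs \<xi> n] drop_xtake [of d ds \<xi> n]
        by (auto simp: bs'_def ds'_def n_def cylinder_iff)
      have fp: "(b, xtake n \<xi>) \<in> fpaths E" using xtake_fpaths P by blast
      have cyl: "\<xi> \<in> cylinder E (b, xtake n \<xi>)"
        using P fp by (simp add: cylinder_iff)
      have E: "a = c" "as @ act_edges A g bs' = cs @ act_edges A h ds'"
          "res_edges A g bs' = res_edges A h ds'"
        using N [of n] True by (auto simp: p q germ_data_def Let_def bs'_def ds'_def n_def)
      have "(psource E (b, bs), bs') \<in> fpaths E" "(psource E (d, ds), ds') \<in> fpaths E"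
        using fp ds Q(2) bs by (metis fpaths_append)+
      then show "(p, q) \<in> germ_rel A"
        using True E bs ds cyl Q(2) unfolding germ_rel_def p q
        by (auto simp: bex_fpaths_at pconcat_def act_path_def res_path_def)
    qed
  next
    case False
    then show ?thesis by (auto simp: germ_rel_def p q)
  qed
qed

text \<open>Transitivity is immediate from eventual equality, beyond the larger of the two
  thresholds, with no search for a common refinement of prefixes.\<close>

lemma equiv_germ_rel: "equiv (quads A) (germ_rel A)"
proof (rule equivI)
  show "germ_rel A \<subseteq> quads A \<times> quads A" by (auto simp: germ_rel_iff)
  show "refl_on (quads A) (germ_rel A)" by (auto simp: refl_on_def germ_rel_iff)
  show "sym (germ_rel A)" by (auto simp: sym_def germ_rel_iff) metis
  show "trans (germ_rel A)"
  proof (rule transI)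
    fix p q r assume "(p, q) \<in> germ_rel A" "(q, r) \<in> germ_rel A"
    then obtain M N where "\<And>n. n \<ge> M \<Longrightarrow> germ_data A n p = germ_data A n q"
      "\<And>n. n \<ge> N \<Longrightarrow> germ_data A n q = germ_data A n r"
      "p \<in> quads A" "r \<in> quads A" "quad_source A p = quad_source A r"
      by (auto simp: germ_rel_iff)
    then show "(p, r) \<in> germ_rel A"
      by (auto simp: germ_rel_iff intro!: exI [of _ "max M N"])
  qed
qed

lemma germ_eq_iff:
  "p \<in> quads A \<Longrightarrow> q \<in> quads A \<Longrightarrow> germ A p = germ A q \<longleftrightarrow> (p, q) \<in> germ_rel A"
  unfolding germ_def by (rule eq_equiv_class_iff [OF equiv_germ_rel])

lemma unit_quad:
  assumes "\<xi> \<in> boundary_paths E"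
  shows "((xrange E \<xi>, []), xrange E \<xi>, (xrange E \<xi>, []), \<xi>) \<in> quads A"
proof -
  have \<xi>: "\<xi> \<in> xpaths E" using assms boundary_paths_xpaths by blast
  then have v: "xrange E \<xi> \<in> verts E" using xtake_fpaths fpaths_verts by blast
  have "xtake 0 \<xi> = []" by (cases \<xi>) auto
  then show ?thesis
    using assms \<xi> v units_arrows src_unit rng_unit by (auto simp: quads_def cylinder_iff units_verts)
qed

lemma unit_germ_eq: "unit_germ A \<xi> = germ A ((xrange E \<xi>, []), xrange E \<xi>, (xrange E \<xi>, []), \<xi>)"
  by (simp add: unit_germ_def Let_def)

text \<open>A vertex acts and restricts trivially, so the defining relation collapses to one
  extension \<open>cs\<close> of \<beta> after which the germ is visibly a unit. This is how units
  are recognised later.\<close>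

lemma germ_eq_unit_germ_iff:
  assumes q: "((a, as), g, (b, bs), \<xi>) \<in> quads A"
  shows "germ A ((a, as), g, (b, bs), \<xi>) = unit_germ A \<xi> \<longleftrightarrow>
    (\<exists>cs. (b, bs @ cs) \<in> fpaths E \<and> \<xi> \<in> cylinder E (b, bs @ cs) \<and>
       a = b \<and> as @ act_edges A g cs = bs @ cs \<and> res_edges A g cs = psource E (b, bs @ cs))"
proof -
  have \<xi>: "\<xi> \<in> boundary_paths E" "xrange E \<xi> = b" "(b, bs) \<in> fpaths E"
    using q by (auto elim!: quad_cases)
  show ?thesis
    using q unit_quad [OF \<xi>(1)] \<xi>(2,3)
    by (auto simp: unit_germ_eq germ_eq_iff germ_rel_def bex_fpaths_at pconcat_def act_path_def
        res_path_def act_edges_unit_fixes res_edges_unit)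
qed

lemma unit_germ_inj:
  assumes "\<xi> \<in> boundary_paths E" "\<eta> \<in> boundary_paths E" "unit_germ A \<xi> = unit_germ A \<eta>"
  shows "\<xi> = \<eta>"
  using assms(3) unfolding unit_germ_eq
  by (simp add: germ_eq_iff unit_quad assms(1,2) germ_rel_iff)

lemma quad_remainder:
  assumes "(\<alpha>, g, \<beta>, \<xi>) \<in> quads A"
  obtains \<eta> where "\<eta> \<in> xpaths_at E (src (grp A) g)" "\<eta> \<in> boundary_paths E" "\<xi> = xconcat \<beta> \<eta>"
    "quad_range A (\<alpha>, g, \<beta>, \<xi>) = xconcat \<alpha> (act_xpath A g \<eta>)"
proof -
  have *: "\<beta> \<in> fpaths E" "src (grp A) g = psource E \<beta>" "\<xi> \<in> cylinder E \<beta>" "\<xi> \<in> boundary_paths E"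
    using assms by (auto simp: quads_def)
  then obtain \<eta> where "\<eta> \<in> xpaths_at E (psource E \<beta>)" "\<xi> = xconcat \<beta> \<eta>"
    by (auto simp: cylinder_def)
  then show ?thesis using that * xconcat_boundary_iff xremainder_xconcat by auto
qed

lemma quad_range_closed:
  assumes "(\<alpha>, g, \<beta>, \<xi>) \<in> quads A"
  shows quad_range_boundary: "quad_range A (\<alpha>, g, \<beta>, \<xi>) \<in> boundary_paths E"
    and xrange_quad_range: "xrange E (quad_range A (\<alpha>, g, \<beta>, \<xi>)) = fst \<alpha>"
proof -
  have *: "\<alpha> \<in> fpaths E" "rng (grp A) g = psource E \<alpha>" "g \<in> arrows (grp A)"
    using assms by (auto simp: quads_def)
  obtain \<eta> where \<eta>: "\<eta> \<in> xpaths_at E (src (grp A) g)" "\<eta> \<in> boundary_paths E"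
    "quad_range A (\<alpha>, g, \<beta>, \<xi>) = xconcat \<alpha> (act_xpath A g \<eta>)"
    using assms by (rule quad_remainder)
  note act_xpath_at [OF *(3) \<eta>(1)] act_xpath_boundary [OF *(3) \<eta>(1,2)]
  then show "quad_range A (\<alpha>, g, \<beta>, \<xi>) \<in> boundary_paths E"
    "xrange E (quad_range A (\<alpha>, g, \<beta>, \<xi>)) = fst \<alpha>"
    using * \<eta>(3) xrange_xconcat xconcat_boundary_iff by metis+
qed

text \<open>The range replaces the prefix \<beta> by \<alpha>, and the action keeps lengths; hence
  the shift of the truncation length by |\<alpha>| - |\<beta>|.\<close>

lemma xtake_quad_range:
  assumes "(\<alpha>, g, \<beta>, \<xi>) \<in> quads A" "n \<ge> length (snd \<beta>)"
  shows "xtake (length (snd \<alpha>) + (n - length (snd \<beta>))) (quad_range A (\<alpha>, g, \<beta>, \<xi>)) =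
    snd (fst (germ_data A n (\<alpha>, g, \<beta>, \<xi>)))"
proof -
  obtain \<eta> where \<eta>: "\<xi> = xconcat \<beta> \<eta>"
    "quad_range A (\<alpha>, g, \<beta>, \<xi>) = xconcat \<alpha> (act_xpath A g \<eta>)"
    using assms(1) by (rule quad_remainder)
  show ?thesis
    using assms(2) unfolding \<eta>(2) by (simp add: germ_data_def Let_def \<eta>(1) xtake_xconcat xtake_act_xpath)
qed

text \<open>\<open>germ_data\<close> determines the truncations of the range, and representatives of
  one germ eventually have the same \<open>germ_data\<close>. This makes the range map of the tight
  groupoid well defined.\<close>

lemma quad_range_cong:
  assumes "(p, q) \<in> germ_rel A"
  shows "quad_range A p = quad_range A q"
proof -
  obtain \<alpha> g \<beta> \<xi> where p: "p = (\<alpha>, g, \<beta>, \<xi>)" by (metis surj_pair)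
  obtain \<gamma> h \<delta> \<eta> where q: "q = (\<gamma>, h, \<delta>, \<eta>)" by (metis surj_pair)
  have pq: "(\<alpha>, g, \<beta>, \<xi>) \<in> quads A" "(\<gamma>, h, \<delta>, \<eta>) \<in> quads A"
    using assms by (auto simp: germ_rel_iff p q)
  obtain N where N: "\<And>n. n \<ge> N \<Longrightarrow> germ_data A n p = germ_data A n q"
    using assms by (auto simp: germ_rel_iff)
  show ?thesis
  proof (rule xpath_eqI)
    show "xrange E (quad_range A p) = xrange E (quad_range A q)"
      using N [of N] unfolding p q xrange_quad_range [OF pq(1)] xrange_quad_range [OF pq(2)]
      by (simp add: germ_data_def Let_def)
    fix m
    \<comment> \<open>Past both prefixes and the threshold N; the summand m makes both truncation
      lengths at least m.\<close>
    let ?n = "N + m + length (snd \<beta>) + length (snd \<delta>)"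
    have "xtake (length (snd \<alpha>) + (?n - length (snd \<beta>))) (quad_range A p) =
      xtake (length (snd \<gamma>) + (?n - length (snd \<delta>))) (quad_range A q)"
      using N [of ?n] xtake_quad_range [OF pq(1), of ?n] xtake_quad_range [OF pq(2), of ?n]
      by (simp add: p q)
    then show "\<exists>a\<ge>m. \<exists>b\<ge>m. xtake a (quad_range A p) = xtake b (quad_range A q)"
      by (intro exI conjI) auto
  qed
qed

end


section \<open>Range, source and isotropy of germs; neighbourhoods of germs and of boundary
  paths\<close>

section \<open>Isotropy and the topology of the tight groupoid\<close>

context self_similar_action
begin

abbreviation "\<G> \<equiv> tight_groupoid A"

lemma arrows_tight: "arrows \<G> = germ A ` quads A"
  unfolding tight_groupoid_def groupoid.simps quotient_def germ_def by blast

lemma mem_germ_iff: "p \<in> germ A q \<longleftrightarrow> (q, p) \<in> germ_rel A"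
  by (simp add: germ_def)

lemma germ_self: "q \<in> quads A \<Longrightarrow> q \<in> germ A q"
  by (simp add: mem_germ_iff germ_rel_iff)

lemma src_tight:
  assumes "q \<in> quads A"
  shows "src \<G> (germ A q) = unit_germ A (quad_source A q)"
proof -
  have "the_elem ((\<lambda>p. unit_germ A (quad_source A p)) ` germ A q) = unit_germ A (quad_source A q)"
  proof (rule the_elem_image_unique)
    show "germ A q \<noteq> {}" using germ_self [OF assms] by blast
    show "unit_germ A (quad_source A p) = unit_germ A (quad_source A q)" if "p \<in> germ A q" for p
      using that by (simp add: mem_germ_iff germ_rel_iff)
  qed
  then show ?thesis unfolding tight_groupoid_def groupoid.simps .
qed

lemma rng_tight:
  assumes "q \<in> quads A"
  shows "rng \<G> (germ A q) = unit_germ A (quad_range A q)"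
proof -
  have "the_elem ((\<lambda>p. unit_germ A (quad_range A p)) ` germ A q) = unit_germ A (quad_range A q)"
  proof (rule the_elem_image_unique)
    show "germ A q \<noteq> {}" using germ_self [OF assms] by blast
    show "unit_germ A (quad_range A p) = unit_germ A (quad_range A q)" if "p \<in> germ A q" for p
      using that quad_range_cong mem_germ_iff by metis
  qed
  then show ?thesis unfolding tight_groupoid_def groupoid.simps .
qed

text \<open>\<open>unit_germ\<close> is injective on boundary paths, so isotropy of a germ is an
  equation between boundary paths.\<close>

lemma isotropy_iff:
  assumes "(\<alpha>, g, \<beta>, \<xi>) \<in> quads A"
  shows "germ A (\<alpha>, g, \<beta>, \<xi>) \<in> {\<gamma> \<in> arrows \<G>. rng \<G> \<gamma> = src \<G> \<gamma>} \<longleftrightarrow>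
    quad_range A (\<alpha>, g, \<beta>, \<xi>) = \<xi>"
proof -
  have "\<xi> \<in> boundary_paths E" using assms by (auto simp: quads_def)
  then have "unit_germ A (quad_range A (\<alpha>, g, \<beta>, \<xi>)) = unit_germ A \<xi> \<longleftrightarrow>
      quad_range A (\<alpha>, g, \<beta>, \<xi>) = \<xi>"
    using quad_range_boundary [OF assms] unit_germ_inj by metis
  moreover have "germ A (\<alpha>, g, \<beta>, \<xi>) \<in> arrows \<G>"
    using assms unfolding arrows_tight by (rule imageI)
  ultimately show ?thesis
    unfolding mem_Collect_eq rng_tight [OF assms] src_tight [OF assms] quad_source.simps by simp
qed

text \<open>A germ determines its base point, so the only candidate is the unit at \<xi>.\<close>

lemma units_tight_iff:
  assumes "(\<alpha>, g, \<beta>, \<xi>) \<in> quads A"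
  shows "germ A (\<alpha>, g, \<beta>, \<xi>) \<in> units \<G> \<longleftrightarrow> germ A (\<alpha>, g, \<beta>, \<xi>) = unit_germ A \<xi>"
proof
  assume "germ A (\<alpha>, g, \<beta>, \<xi>) \<in> units \<G>"
  then obtain \<eta> where \<eta>: "\<eta> \<in> boundary_paths E" "germ A (\<alpha>, g, \<beta>, \<xi>) = unit_germ A \<eta>"
    by (auto simp: tight_groupoid_def)
  then have "\<xi> = \<eta>"
    using assms unit_quad [OF \<eta>(1)] by (simp add: unit_germ_eq germ_eq_iff germ_rel_iff)
  then show "germ A (\<alpha>, g, \<beta>, \<xi>) = unit_germ A \<xi>" using \<eta> by simp
qed (use assms in \<open>auto simp: tight_groupoid_def quads_def\<close>)

lemma openin_boundary_cylinder_minus: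
  assumes "\<alpha> \<in> fpaths E" "finite F" "F \<subseteq> fpaths_at E (psource E \<alpha>)"
  shows "openin (boundary_topology E)
    ((cylinder E \<alpha> - (\<Union>\<beta>\<in>F. cylinder E (pconcat \<alpha> \<beta>))) \<inter> boundary_paths E)"
proof -
  have "openin (path_topology E) (cylinder E \<alpha> - (\<Union>\<beta>\<in>F. cylinder E (pconcat \<alpha> \<beta>)))"
    unfolding path_topology_def by (rule topology_generated_by_Basis) (use assms in blast)
  then show ?thesis
    unfolding boundary_topology_def openin_subtopology by blast
qed

lemma openin_boundary_cylinder:
  "\<alpha> \<in> fpaths E \<Longrightarrow> openin (boundary_topology E) (cylinder E \<alpha> \<inter> boundary_paths E)"
  using openin_boundary_cylinder_minus [of \<alpha> "{}"] by simp

lemma openin_boundary_subset: "openin (boundary_topology E) V \<Longrightarrow> V \<subseteq> boundary_paths E"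
  by (auto simp: boundary_topology_def openin_subtopology)

lemma openin_tight_basic:
  assumes "\<alpha> \<in> fpaths E" "g \<in> arrows (grp A)" "\<beta> \<in> fpaths E" "rng (grp A) g = psource E \<alpha>"
    "src (grp A) g = psource E \<beta>" "openin (boundary_topology E) V" "V \<subseteq> cylinder E \<beta>"
  shows "openin (arrow_topology \<G>) ((\<lambda>\<xi>. germ A (\<alpha>, g, \<beta>, \<xi>)) ` V)"
  unfolding tight_groupoid_def top_groupoid.simps
  by (rule topology_generated_by_Basis) (use assms in blast)

text \<open>A basic set around the germ may come from another triple \<gamma>, h, \<delta>. The
  extensions \<beta>', \<delta>' that identify the two germs at \<xi> also identify them at nearby
  points with prefix \<beta>\<beta>', so the given triple can be kept.\<close>

lemma openin_tight_nhd:
  assumes U: "openin (arrow_topology \<G>) U" and q: "(\<alpha>, g, \<beta>, \<xi>) \<in> quads A"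
    and "germ A (\<alpha>, g, \<beta>, \<xi>) \<in> U"
  shows "\<exists>V. openin (boundary_topology E) V \<and> \<xi> \<in> V \<and> V \<subseteq> cylinder E \<beta> \<and>
    (\<forall>\<eta>\<in>V. germ A (\<alpha>, g, \<beta>, \<eta>) \<in> U)"
proof -
  define N where "N \<equiv> \<lambda>U. \<exists>V. openin (boundary_topology E) V \<and> \<xi> \<in> V \<and> V \<subseteq> cylinder E \<beta> \<and>
    (\<forall>\<eta>\<in>V. germ A (\<alpha>, g, \<beta>, \<eta>) \<in> U)"
  have "N U"
  proof (rule openin_generated_nhd [where N = N])
    show "openin (topology_generated_by {(\<lambda>\<xi>. germ A (\<alpha>, g, \<beta>, \<xi>)) ` V | \<alpha> g \<beta> V.
           \<alpha> \<in> fpaths (gra A) \<and> g \<in> arrows (grp A) \<and> \<beta> \<in> fpaths (gra A) \<and>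
           rng (grp A) g = psource (gra A) \<alpha> \<and> src (grp A) g = psource (gra A) \<beta> \<and>
           openin (boundary_topology (gra A)) V \<and> V \<subseteq> cylinder (gra A) \<beta>}) U"
      using U by (simp add: tight_groupoid_def)
    show "germ A (\<alpha>, g, \<beta>, \<xi>) \<in> U" by fact
  next
    fix S T assume "N S" "N T"
    then obtain V W where "openin (boundary_topology E) V \<and> \<xi> \<in> V \<and> V \<subseteq> cylinder E \<beta> \<and>
        (\<forall>\<eta>\<in>V. germ A (\<alpha>, g, \<beta>, \<eta>) \<in> S)"
      "openin (boundary_topology E) W \<and> \<xi> \<in> W \<and> W \<subseteq> cylinder E \<beta> \<and>
        (\<forall>\<eta>\<in>W. germ A (\<alpha>, g, \<beta>, \<eta>) \<in> T)"
      unfolding N_def by blast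
    then show "N (S \<inter> T)"
      unfolding N_def by (intro exI [of _ "V \<inter> W"]) auto
  next
    fix S assume "S \<in> {(\<lambda>\<xi>. germ A (\<alpha>, g, \<beta>, \<xi>)) ` V | \<alpha> g \<beta> V.
           \<alpha> \<in> fpaths (gra A) \<and> g \<in> arrows (grp A) \<and> \<beta> \<in> fpaths (gra A) \<and>
           rng (grp A) g = psource (gra A) \<alpha> \<and> src (grp A) g = psource (gra A) \<beta> \<and>
           openin (boundary_topology (gra A)) V \<and> V \<subseteq> cylinder (gra A) \<beta>}"
      and germ: "germ A (\<alpha>, g, \<beta>, \<xi>) \<in> S"
    then obtain \<gamma> h \<delta> V where S: "S = (\<lambda>\<xi>. germ A (\<gamma>, h, \<delta>, \<xi>)) ` V" "\<gamma> \<in> fpaths E"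
      "h \<in> arrows (grp A)" "\<delta> \<in> fpaths E" "rng (grp A) h = psource E \<gamma>"
      "src (grp A) h = psource E \<delta>" "openin (boundary_topology E) V" "V \<subseteq> cylinder E \<delta>"
      by blast
    have V: "(\<gamma>, h, \<delta>, \<eta>) \<in> quads A" if "\<eta> \<in> V" for \<eta>
      using S that openin_boundary_subset by (auto simp: quads_def)
    obtain \<eta> where "\<eta> \<in> V" "germ A (\<alpha>, g, \<beta>, \<xi>) = germ A (\<gamma>, h, \<delta>, \<eta>)"
      using germ S by blast
    then have \<xi>: "\<xi> \<in> V" and rel: "((\<alpha>, g, \<beta>, \<xi>), (\<gamma>, h, \<delta>, \<xi>)) \<in> germ_rel A"
      using V q by (auto simp: germ_eq_iff germ_rel_iff)
    then obtain \<beta>' \<delta>' where \<beta>': "\<beta>' \<in> fpaths_at E (psource E \<beta>)" "\<delta>' \<in> fpaths_at E (psource E \<delta>)"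
        "pconcat \<beta> \<beta>' = pconcat \<delta> \<delta>'" "\<xi> \<in> cylinder E (pconcat \<beta> \<beta>')"
        "pconcat \<alpha> (act_path A g \<beta>') = pconcat \<gamma> (act_path A h \<delta>')"
        "res_path A g \<beta>' = res_path A h \<delta>'"
      unfolding germ_rel_def by blast
    have \<beta>: "\<beta> \<in> fpaths E" "\<xi> \<in> cylinder E \<beta>" using q by (auto simp: quads_def)
    then have fp: "pconcat \<beta> \<beta>' \<in> fpaths E"
      using \<beta>'(1) by (cases \<beta>) (auto simp: fpaths_at_iff pconcat_def)
    \<comment> \<open>The cylinder of \<beta>\<beta>' keeps the witnesses \<beta>', \<delta>' valid;
      the one of \<beta> ensures that the given triple has germs there.\<close>
    let ?W = "V \<inter> (cylinder E \<beta> \<inter> boundary_paths E) \<inter>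
      (cylinder E (pconcat \<beta> \<beta>') \<inter> boundary_paths E)"
    have "germ A (\<alpha>, g, \<beta>, \<eta>) \<in> S" if \<eta>: "\<eta> \<in> ?W" for \<eta>
    proof -
      have "(\<alpha>, g, \<beta>, \<eta>) \<in> quads A" using q \<eta> by (auto simp: quads_def)
      moreover from this have "((\<alpha>, g, \<beta>, \<eta>), (\<gamma>, h, \<delta>, \<eta>)) \<in> germ_rel A"
        using \<beta>' \<eta> V unfolding germ_rel_def by blast
      ultimately show ?thesis using \<eta> V S(1) germ_eq_iff by blast
    qed
    moreover have "openin (boundary_topology E) ?W"
      by (intro openin_Int S(7) openin_boundary_cylinder \<beta> fp)
    moreover have "\<xi> \<in> ?W" using \<xi> \<beta> \<beta>'(4) q by (auto simp: quads_def)
    ultimately show "N S" unfolding N_def by blast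
  qed (auto simp: N_def)
  then show ?thesis by (simp add: N_def)
qed

text \<open>Fixing every truncation passes to the possibly infinite path itself. This verifies
  isotropy for germs whose two paths are the same vertex.\<close>

lemma quad_range_fixed:
  assumes g: "g \<in> arrows (grp A)" "src (grp A) g = v" "rng (grp A) g = v"
    and \<xi>: "\<xi> \<in> boundary_paths E" "xrange E \<xi> = v"
    and fixed: "\<And>n. act_edges A g (xtake n \<xi>) = xtake n \<xi>"
  shows fixed_quad: "((v, []), g, (v, []), \<xi>) \<in> quads A"
    and quad_range_fixed_quad: "quad_range A ((v, []), g, (v, []), \<xi>) = \<xi>"
proof -
  show q: "((v, []), g, (v, []), \<xi>) \<in> quads A"
    using unit_quad [OF \<xi>(1)] g \<xi> by (simp add: quads_def)
  show "quad_range A ((v, []), g, (v, []), \<xi>) = \<xi>"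
  proof (rule xpath_eqI)
    show "xrange E (quad_range A ((v, []), g, (v, []), \<xi>)) = xrange E \<xi>"
      unfolding xrange_quad_range [OF q] using \<xi> by simp
    have "xtake n (quad_range A ((v, []), g, (v, []), \<xi>)) = xtake n \<xi>" for n
      using xtake_quad_range [OF q, of n] fixed [of n]
      by (simp add: germ_data_def Let_def del: quad_range.simps)
    then show "\<exists>a\<ge>m. \<exists>b\<ge>m. xtake a (quad_range A ((v, []), g, (v, []), \<xi>)) = xtake b \<xi>" for m
      by blast
  qed
qed

lemma quads_change:
  assumes "(\<alpha>, g, \<beta>, \<xi>) \<in> quads A" "openin (boundary_topology E) V" "V \<subseteq> cylinder E \<beta>" "\<eta> \<in> V"
  shows "(\<alpha>, g, \<beta>, \<eta>) \<in> quads A"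
  using assms openin_boundary_subset by (auto simp: quads_def)

lemma units_tight: "units \<G> = unit_germ A ` boundary_paths E"
  by (simp add: tight_groupoid_def)

text \<open>The germs of the triple v, v, v with v = r(\<xi>) form an open set of isotropic arrows.
  So units always lie in the interior, and effectiveness concerns only the other inclusion.\<close>

lemma unit_germ_interior:
  assumes "\<xi> \<in> boundary_paths E"
  shows "unit_germ A \<xi> \<in> arrow_topology \<G> interior_of {\<gamma> \<in> arrows \<G>. rng \<G> \<gamma> = src \<G> \<gamma>}"
proof -
  define v where "v = xrange E \<xi>"
  define V where "V = cylinder E (v, []) \<inter> boundary_paths E"
  have q: "((v, []), v, (v, []), \<xi>) \<in> quads A" using unit_quad assms v_def by simp
  then have v: "(v, []) \<in> fpaths E" "v \<in> arrows (grp A)" "rng (grp A) v = psource E (v, [])"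
    "src (grp A) v = psource E (v, [])" and \<xi>: "\<xi> \<in> V"
    by (auto simp: quads_def V_def)
  have V: "openin (boundary_topology E) V" "V \<subseteq> cylinder E (v, [])"
    using openin_boundary_cylinder [OF v(1)] by (auto simp: V_def)
  define U where "U = (\<lambda>\<eta>. germ A ((v, []), v, (v, []), \<eta>)) ` V"
  have "openin (arrow_topology \<G>) U"
    unfolding U_def by (rule openin_tight_basic) (fact v V)+
  moreover have "unit_germ A \<xi> \<in> U"
    unfolding U_def unit_germ_eq v_def [symmetric] using \<xi> by (rule imageI)
  moreover have "U \<subseteq> {\<gamma> \<in> arrows \<G>. rng \<G> \<gamma> = src \<G> \<gamma>}"
  proof
    fix \<Delta> assume "\<Delta> \<in> U"
    then obtain \<eta> where \<eta>: "\<eta> \<in> V" "\<Delta> = germ A ((v, []), v, (v, []), \<eta>)"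
      unfolding U_def by blast
    have bd: "xrange E \<eta> = v" "\<eta> \<in> boundary_paths E" "\<eta> \<in> xpaths E"
      using \<eta>(1) v(1) by (auto simp: cylinder_iff V_def)
    then have "act_edges A v (xtake n \<eta>) = xtake n \<eta>" for n
      using xtake_fpaths act_edges_unit_fixes by blast
    then have "quad_range A ((v, []), v, (v, []), \<eta>) = \<eta>"
      using bd v by (intro quad_range_fixed_quad) auto
    then show "\<Delta> \<in> {\<gamma> \<in> arrows \<G>. rng \<G> \<gamma> = src \<G> \<gamma>}"
      unfolding \<eta>(2) isotropy_iff [OF quads_change [OF q V \<eta>(1)]] .
  qed
  ultimately show ?thesis
    unfolding interior_of_def mem_Collect_eq by (intro exI conjI)
qed

text \<open>Basic open sets give one direction, and \<open>openin_tight_nhd\<close> gives the other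
  by keeping the triple of a germ. Effectiveness then involves only open sets of boundary
  paths.\<close>

lemma effective_iff:
  "effective \<G> \<longleftrightarrow>
    (\<forall>\<alpha> g \<beta> \<xi> V. (\<alpha>, g, \<beta>, \<xi>) \<in> quads A \<longrightarrow> openin (boundary_topology E) V \<longrightarrow> \<xi> \<in> V \<longrightarrow>
      V \<subseteq> cylinder E \<beta> \<longrightarrow> (\<forall>\<eta>\<in>V. quad_range A (\<alpha>, g, \<beta>, \<eta>) = \<eta>) \<longrightarrow>
      germ A (\<alpha>, g, \<beta>, \<xi>) = unit_germ A \<xi>)"
  (is "_ \<longleftrightarrow> ?R")
proof
  assume eff: "effective \<G>"
  show ?R
  proof (intro allI impI)
    fix \<alpha> g \<beta> \<xi> V
    assume q: "(\<alpha>, g, \<beta>, \<xi>) \<in> quads A" and V: "openin (boundary_topology E) V" "\<xi> \<in> V"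
      "V \<subseteq> cylinder E \<beta>" and range: "\<forall>\<eta>\<in>V. quad_range A (\<alpha>, g, \<beta>, \<eta>) = \<eta>"
    define U where "U = (\<lambda>\<eta>. germ A (\<alpha>, g, \<beta>, \<eta>)) ` V"
    have "openin (arrow_topology \<G>) U"
      unfolding U_def using q V by (intro openin_tight_basic) (auto simp: quads_def)
    moreover have "germ A (\<alpha>, g, \<beta>, \<xi>) \<in> U"
      unfolding U_def using V(2) by (rule imageI)
    moreover have "U \<subseteq> {\<gamma> \<in> arrows \<G>. rng \<G> \<gamma> = src \<G> \<gamma>}"
    proof (unfold U_def, rule image_subsetI)
      fix \<eta> assume \<eta>: "\<eta> \<in> V"
      show "germ A (\<alpha>, g, \<beta>, \<eta>) \<in> {\<gamma> \<in> arrows \<G>. rng \<G> \<gamma> = src \<G> \<gamma>}"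
        unfolding isotropy_iff [OF quads_change [OF q V(1,3) \<eta>]] using range \<eta> by (rule bspec)
    qed
    ultimately have "germ A (\<alpha>, g, \<beta>, \<xi>) \<in>
        arrow_topology \<G> interior_of {\<gamma> \<in> arrows \<G>. rng \<G> \<gamma> = src \<G> \<gamma>}"
      unfolding interior_of_def mem_Collect_eq by (intro exI conjI)
    then have "germ A (\<alpha>, g, \<beta>, \<xi>) \<in> units \<G>"
      unfolding eff [unfolded effective_def] .
    then show "germ A (\<alpha>, g, \<beta>, \<xi>) = unit_germ A \<xi>"
      unfolding units_tight_iff [OF q] .
  qed
next
  assume R: ?R
  show "effective \<G>"
    unfolding effective_def
  proof (rule subset_antisym)
    show "units \<G> \<subseteq> arrow_topology \<G> interior_of {\<gamma> \<in> arrows \<G>. rng \<G> \<gamma> = src \<G> \<gamma>}"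
      unfolding units_tight image_subset_iff using unit_germ_interior by blast
  next
    show "arrow_topology \<G> interior_of {\<gamma> \<in> arrows \<G>. rng \<G> \<gamma> = src \<G> \<gamma>} \<subseteq> units \<G>"
    proof
      fix \<Gamma>
      assume "\<Gamma> \<in> arrow_topology \<G> interior_of {\<gamma> \<in> arrows \<G>. rng \<G> \<gamma> = src \<G> \<gamma>}"
      then obtain U where U: "openin (arrow_topology \<G>) U" "\<Gamma> \<in> U"
        "U \<subseteq> {\<gamma> \<in> arrows \<G>. rng \<G> \<gamma> = src \<G> \<gamma>}"
        unfolding interior_of_def mem_Collect_eq by (elim exE conjE)
      have "\<Gamma> \<in> germ A ` quads A" using U(2,3) arrows_tight by blast
      then obtain \<alpha> g \<beta> \<xi> where q: "(\<alpha>, g, \<beta>, \<xi>) \<in> quads A" "\<Gamma> = germ A (\<alpha>, g, \<beta>, \<xi>)"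
        by (elim imageE) (metis surj_pair)
      obtain V where V: "openin (boundary_topology E) V" "\<xi> \<in> V" "V \<subseteq> cylinder E \<beta>"
        "\<forall>\<eta>\<in>V. germ A (\<alpha>, g, \<beta>, \<eta>) \<in> U"
        using openin_tight_nhd [OF U(1) q(1) U(2) [unfolded q(2)]] by blast
      have "quad_range A (\<alpha>, g, \<beta>, \<eta>) = \<eta>" if \<eta>: "\<eta> \<in> V" for \<eta>
        using subsetD [OF U(3) bspec [OF V(4) \<eta>]]
        unfolding isotropy_iff [OF quads_change [OF q(1) V(1,3) \<eta>]] .
      then have "germ A (\<alpha>, g, \<beta>, \<xi>) = unit_germ A \<xi>" using R q(1) V(1-3) by blast
      then show "\<Gamma> \<in> units \<G>" unfolding q(2) units_tight_iff [OF q(1)] .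
    qed
  qed
qed

text \<open>A basic set is cut out by finitely many finite paths, so finitely many edges of
  \<open>x\<close> decide membership near it.\<close>

lemma openin_boundary_nhd_infinite:
  assumes "openin (boundary_topology E) V" "InfPath x \<in> V"
  shows "\<exists>n. cylinder E (head E (shd x), stake n x) \<inter> boundary_paths E \<subseteq> V"
proof -
  have x: "InfPath x \<in> xpaths E"
    using assms openin_boundary_subset boundary_paths_xpaths by blast
  then have fp: "(head E (shd x), stake n x) \<in> fpaths E" for n
    using xtake_fpaths [of "InfPath x" n] by simp
  \<comment> \<open>All later cylinders are included in \<open>N\<close>, so that two thresholds
    combine to their maximum.\<close>
  define N where "N \<equiv> \<lambda>S. \<exists>n. \<forall>m\<ge>n. cylinder E (head E (shd x), stake m x) \<subseteq> S"
  obtain U where U: "openin (path_topology E) U" "V = U \<inter> boundary_paths E"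
    using assms(1) unfolding boundary_topology_def openin_subtopology by blast
  have "N U"
  proof (rule openin_generated_nhd [where N = N])
    show "InfPath x \<in> U" using assms U by blast
    fix S T assume "N S" "N T"
    then obtain n m where "\<forall>k\<ge>n. cylinder E (head E (shd x), stake k x) \<subseteq> S"
      "\<forall>k\<ge>m. cylinder E (head E (shd x), stake k x) \<subseteq> T"
      unfolding N_def by blast
    then show "N (S \<inter> T)" unfolding N_def by (intro exI [of _ "max n m"]) auto
  next
    fix S assume "S \<in> {cylinder E \<alpha> - (\<Union>\<beta>\<in>F. cylinder E (pconcat \<alpha> \<beta>)) | \<alpha> F.
        \<alpha> \<in> fpaths E \<and> finite F \<and> F \<subseteq> fpaths_at E (psource E \<alpha>)}" and xS: "InfPath x \<in> S"
    then obtain \<alpha> F where S: "S = cylinder E \<alpha> - (\<Union>\<beta>\<in>F. cylinder E (pconcat \<alpha> \<beta>))"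
      "\<alpha> \<in> fpaths E" "finite F" "F \<subseteq> fpaths_at E (psource E \<alpha>)" by blast
    obtain a as where \<alpha>: "\<alpha> = (a, as)" by force
    obtain k where k: "\<And>\<beta>. \<beta> \<in> F \<Longrightarrow> length (snd \<beta>) \<le> k"
      using S(3) finite_nat_set_iff_bounded_le [of "(\<lambda>\<beta>. length (snd \<beta>)) ` F"] by auto
    \<comment> \<open>Cylinders of paths with at most m edges do not separate points that share
      their range and first m edges.\<close>
    have cyl: "\<eta> \<in> cylinder E (v, es) \<longleftrightarrow> InfPath x \<in> cylinder E (v, es)"
      if "(v, es) \<in> fpaths E" "length es \<le> m" "\<eta> \<in> cylinder E (head E (shd x), stake m x)"
      for \<eta> m v es
    proof -
      have "\<eta> \<in> xpaths E" "xrange E \<eta> = head E (shd x)" "xtake m \<eta> = stake m x"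
        using that(3) fp [of m] by (auto simp: cylinder_iff)
      then show ?thesis
        using that(1,2) x take_xtake [of "length es" m \<eta>] take_xtake [of "length es" m "InfPath x"]
        by (auto simp: cylinder_iff)
    qed
    have "\<eta> \<in> S" if "m \<ge> length as + k" "\<eta> \<in> cylinder E (head E (shd x), stake m x)" for m \<eta>
    proof -
      have "\<eta> \<in> cylinder E \<alpha>" using cyl [of a as m \<eta>] S xS \<alpha> that by auto
      moreover have "\<eta> \<notin> cylinder E (pconcat \<alpha> \<beta>)" if \<beta>: "\<beta> \<in> F" for \<beta>
      proof -
        have "\<beta> \<in> fpaths_at E (psource E \<alpha>)" using S(4) \<beta> by blast
        then obtain bs where bs: "pconcat \<alpha> \<beta> = (a, as @ bs)" "(a, as @ bs) \<in> fpaths E" "snd \<beta> = bs"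
          using S(2) by (auto simp: fpaths_at_iff pconcat_def \<alpha>)
        then show ?thesis
          using cyl [of a "as @ bs" m \<eta>] xS S(1) \<beta> k [OF \<beta>] \<open>m \<ge> length as + k\<close>
            \<open>\<eta> \<in> cylinder E (head E (shd x), stake m x)\<close> by auto
      qed
      ultimately show ?thesis using S(1) by blast
    qed
    then show "N S" unfolding N_def by blast
  qed (use U(1) in \<open>auto simp: N_def path_topology_def\<close>)
  then show ?thesis using U unfolding N_def by blast
qed

text \<open>An excluded path that properly extends \<open>es\<close> can be shortened to its next
  edge after \<open>es\<close>, and an excluded prefix of \<open>es\<close> would exclude the point
  itself. So it suffices to exclude finitely many edges.\<close>

lemma openin_boundary_nhd_finite:
  assumes "openin (boundary_topology E) V" "FinPath (v, es) \<in> V"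
  shows "\<exists>F. finite F \<and>
    (cylinder E (v, es) - (\<Union>e\<in>F. cylinder E (v, es @ [e]))) \<inter> boundary_paths E \<subseteq> V"
proof -
  let ?\<xi> = "FinPath (v, es)"
  have fp: "(v, es) \<in> fpaths E"
    using assms openin_boundary_subset by (fastforce simp: boundary_paths_def)
  then have \<xi>: "?\<xi> \<in> xpaths E" by (auto simp: xpaths_def)
  \<comment> \<open>Truncations replace cylinders because an edge of \<open>F\<close> might not
    continue \<open>es\<close>, and \<open>cylinder_iff\<close> speaks of paths only.\<close>
  define N where "N \<equiv> \<lambda>S. \<exists>F. finite F \<and>
    (\<forall>\<eta>\<in>xpaths E. xrange E \<eta> = v \<and> xtake (length es) \<eta> = es \<and>
       (\<forall>e\<in>F. xtake (Suc (length es)) \<eta> \<noteq> es @ [e]) \<longrightarrow> \<eta> \<in> S)"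
  obtain U where U: "openin (path_topology E) U" "V = U \<inter> boundary_paths E"
    using assms(1) unfolding boundary_topology_def openin_subtopology by blast
  have "N U"
  proof (rule openin_generated_nhd [where N = N])
    show "?\<xi> \<in> U" using assms U by blast
    fix S T assume "N S" "N T"
    then obtain F F' where "finite F \<and>
      (\<forall>\<eta>\<in>xpaths E. xrange E \<eta> = v \<and> xtake (length es) \<eta> = es \<and>
       (\<forall>e\<in>F. xtake (Suc (length es)) \<eta> \<noteq> es @ [e]) \<longrightarrow> \<eta> \<in> S)"
      "finite F' \<and>
      (\<forall>\<eta>\<in>xpaths E. xrange E \<eta> = v \<and> xtake (length es) \<eta> = es \<and>
       (\<forall>e\<in>F'. xtake (Suc (length es)) \<eta> \<noteq> es @ [e]) \<longrightarrow> \<eta> \<in> T)"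
      unfolding N_def by blast
    then show "N (S \<inter> T)" unfolding N_def by (intro exI [of _ "F \<union> F'"]) auto
  next
    fix S assume "S \<in> {cylinder E \<alpha> - (\<Union>\<beta>\<in>F. cylinder E (pconcat \<alpha> \<beta>)) | \<alpha> F.
        \<alpha> \<in> fpaths E \<and> finite F \<and> F \<subseteq> fpaths_at E (psource E \<alpha>)}" and \<xi>S: "?\<xi> \<in> S"
    then obtain \<alpha> F where S: "S = cylinder E \<alpha> - (\<Union>\<beta>\<in>F. cylinder E (pconcat \<alpha> \<beta>))"
      "\<alpha> \<in> fpaths E" "finite F" "F \<subseteq> fpaths_at E (psource E \<alpha>)" by blast
    obtain a as where \<alpha>: "\<alpha> = (a, as)" by force
    \<comment> \<open>If \<open>as @ snd \<beta>\<close> has at most \<open>length es\<close> edges,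
      the index is out of range and yields an unspecified edge; excluding it as well only shrinks
      the neighbourhood.\<close>
    let ?F = "(\<lambda>\<beta>. (as @ snd \<beta>) ! length es) ` F"
    have as: "a = v" "take (length as) es = as"
      using \<xi>S S \<alpha> by (auto simp: cylinder_iff prange_def)
    then have len: "length as \<le> length es" by (metis length_take min.cobounded1)
    have "\<eta> \<in> S" if \<eta>: "\<eta> \<in> xpaths E" "xrange E \<eta> = v" "xtake (length es) \<eta> = es"
      "\<forall>e\<in>?F. xtake (Suc (length es)) \<eta> \<noteq> es @ [e]" for \<eta>
    proof -
      have "\<eta> \<in> cylinder E \<alpha>"
        using S(2) \<eta> as take_xtake [OF len, of \<eta>] by (auto simp: \<alpha> cylinder_iff)
      moreover have "\<eta> \<notin> cylinder E (pconcat \<alpha> \<beta>)" if \<beta>: "\<beta> \<in> F" for \<beta>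
      proof
        assume cyl: "\<eta> \<in> cylinder E (pconcat \<alpha> \<beta>)"
        have "\<beta> \<in> fpaths_at E (psource E \<alpha>)" using S(4) \<beta> by blast
        then obtain bs where bs: "pconcat \<alpha> \<beta> = (a, as @ bs)" "(a, as @ bs) \<in> fpaths E" "snd \<beta> = bs"
          using S(2) by (auto simp: fpaths_at_iff pconcat_def \<alpha>)
        then have xt: "xtake (length (as @ bs)) \<eta> = as @ bs"
          using cyl cylinder_iff by metis
        \<comment> \<open>Either the excluded path is a prefix of \<open>es\<close>, and the centre
          would be excluded, or \<eta> continues \<open>es\<close> by an edge in
          \<open>?F\<close>.\<close>
        show False
        proof (cases "length (as @ bs) \<le> length es")
          case True
          then have "take (length (as @ bs)) es = as @ bs"
            using take_xtake [of "length (as @ bs)" "length es" \<eta>] \<eta> xt by simp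
          then have "?\<xi> \<in> cylinder E (pconcat \<alpha> \<beta>)"
            using bs as \<xi> by (simp add: cylinder_iff prange_def)
          then show False using \<xi>S S(1) \<beta> by blast
        next
          case False
          then have "xtake (Suc (length es)) \<eta> = take (Suc (length es)) (as @ bs)"
            "es = take (length es) (as @ bs)"
            using take_xtake [of "Suc (length es)" "length (as @ bs)" \<eta>]
              take_xtake [of "length es" "length (as @ bs)" \<eta>] \<eta> xt by simp_all
          then have "xtake (Suc (length es)) \<eta> = es @ [(as @ bs) ! length es]"
            using False by (metis not_le take_Suc_conv_app_nth)
          then show False using \<eta>(4) \<beta> bs(3) by blast
        qed
      qed
      ultimately show ?thesis using S(1) by blast
    qed
    then show "N S" using S(3) unfolding N_def by (intro exI [of _ ?F]) blast
  next
    fix S T assume "N S" "S \<subseteq> T"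
    then show "N T" unfolding N_def by (meson subsetD)
  qed (use U(1) in \<open>simp add: path_topology_def\<close>)
  then obtain F where F: "finite F"
    "\<And>\<eta>. \<eta> \<in> xpaths E \<Longrightarrow> xrange E \<eta> = v \<Longrightarrow> xtake (length es) \<eta> = es \<Longrightarrow>
       (\<forall>e\<in>F. xtake (Suc (length es)) \<eta> \<noteq> es @ [e]) \<Longrightarrow> \<eta> \<in> U"
    unfolding N_def by blast
  have "\<eta> \<in> V" if "\<eta> \<in> (cylinder E (v, es) - (\<Union>e\<in>F. cylinder E (v, es @ [e]))) \<inter> boundary_paths E" for \<eta>
  proof -
    have \<eta>: "\<eta> \<in> xpaths E" "xrange E \<eta> = v" "xtake (length es) \<eta> = es"
      using that fp by (auto simp: cylinder_iff)
    have "xtake (Suc (length es)) \<eta> \<noteq> es @ [e]" if e: "e \<in> F" for e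
    proof
      assume *: "xtake (Suc (length es)) \<eta> = es @ [e]"
      then have "(v, es @ [e]) \<in> fpaths E" using xtake_fpaths [OF \<eta>(1)] \<eta>(2) by metis
      then have "\<eta> \<in> cylinder E (v, es @ [e])" using \<eta> * cylinder_iff by simp
      then show False using e \<open>\<eta> \<in> (_ - _) \<inter> _\<close> by blast
    qed
    then show ?thesis using F(2) \<eta> U(2) that by blast
  qed
  then show ?thesis using F(1) by blast
qed

end


section \<open>(Slack), infinite receivers and (Cyc) in an effective tight groupoid\<close>

section \<open>Necessity of the conditions\<close>

context self_similar_action
begin

lemma fixes_path_iff: "fixes_path A g (v, es) \<longleftrightarrow> rng (grp A) g = v \<and> act_edges A g es = es"
  by (simp add: fixes_path_def act_path_def)

lemma strongly_fixed_iff: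
  "(v, es) \<in> strongly_fixed A g \<longleftrightarrow> (v, es) \<in> fpaths E \<and> src (grp A) g = v \<and> rng (grp A) g = v \<and>
     act_edges A g es = es \<and> res_edges A g es = psource E (v, es)"
  by (auto simp: strongly_fixed_def fpaths_at_iff fixes_path_iff res_path_def)

lemma comparable_iff:
  assumes "(v, es) \<in> fpaths E" "(v, fs) \<in> fpaths E"
  shows "comparable E (v, es) (v, fs) \<longleftrightarrow> (\<exists>gs. es = fs @ gs \<or> fs = es @ gs)"
  using assms by (auto simp: comparable_def extends_iff)

text \<open>After a strongly fixed prefix the remaining edges are acted on by a vertex.\<close>

lemma strongly_fixed_append:
  assumes "(v, es) \<in> strongly_fixed A g" "(v, es @ fs) \<in> fpaths E"
  shows "(v, es @ fs) \<in> strongly_fixed A g"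
  using assms act_edges_unit_fixes res_edges_unit by (auto simp: strongly_fixed_iff)

text \<open>Effectiveness gives every boundary path at v a strongly fixed prefix, and Koenig's lemma
  shows that finitely many suffice: otherwise failure would propagate along an infinite path, which
  has such a prefix itself.\<close>

lemma effective_imp_slack:
  assumes eff: "effective \<G>" and g: "g \<in> arrows (grp A)"
    and fixed: "\<forall>\<mu>\<in>fpaths_at E (src (grp A) g). fixes_path A g \<mu>"
  shows "has_slack A g"
proof -
  define v where "v = src (grp A) g"
  have v: "v \<in> verts E" using g src_units units_verts v_def by auto
  have fx: "rng (grp A) g = v" "act_edges A g es = es" if "(v, es) \<in> fpaths E" for es
  proof -
    have "(v, es) \<in> fpaths_at E (src (grp A) g)" using that by (simp add: fpaths_at_iff v_def)
    then have "fixes_path A g (v, es)" using fixed by blast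
    then show "rng (grp A) g = v" "act_edges A g es = es" by (simp_all add: fixes_path_iff)
  qed
  have vg: "src (grp A) g = v" "rng (grp A) g = v"
    using fx(1) [of "[]"] v v_def by auto
  \<comment> \<open>All germs of the triple v, g, v are isotropic, so they are units, and the unit
    criterion names the prefix.\<close>
  have prefix_fixed: "\<exists>cs. \<xi> \<in> cylinder E (v, cs) \<and> (v, cs) \<in> strongly_fixed A g"
    if \<xi>: "\<xi> \<in> boundary_paths E" "xrange E \<xi> = v" for \<xi>
  proof -
    let ?V = "cylinder E (v, []) \<inter> boundary_paths E"
    have *: "((v, []), g, (v, []), \<eta>) \<in> quads A" "quad_range A ((v, []), g, (v, []), \<eta>) = \<eta>"
      if "\<eta> \<in> boundary_paths E" "xrange E \<eta> = v" for \<eta>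
    proof -
      have "act_edges A g (xtake n \<eta>) = xtake n \<eta>" for n
        using that fx(2) xtake_fpaths boundary_paths_xpaths by blast
      then show "((v, []), g, (v, []), \<eta>) \<in> quads A" "quad_range A ((v, []), g, (v, []), \<eta>) = \<eta>"
        using fixed_quad [OF g vg that] quad_range_fixed_quad [OF g vg that] by auto
    qed
    have "\<forall>\<eta>\<in>?V. quad_range A ((v, []), g, (v, []), \<eta>) = \<eta>"
      using * v by (auto simp: cylinder_iff simp del: quad_range.simps)
    moreover have "\<xi> \<in> ?V" using *(1) \<xi> by (simp add: quads_def)
    moreover have "openin (boundary_topology E) ?V" using v by (intro openin_boundary_cylinder) simp
    moreover have "?V \<subseteq> cylinder E (v, [])" by blast
    ultimately have "germ A ((v, []), g, (v, []), \<xi>) = unit_germ A \<xi>"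
      using eff *(1) [OF \<xi>] unfolding effective_iff by blast
    then show ?thesis
      unfolding germ_eq_unit_germ_iff [OF *(1) [OF \<xi>]] using vg by (auto simp: strongly_fixed_iff)
  qed
  \<comment> \<open>A path is good if finitely many strongly fixed paths are comparable with all its
    extensions; goodness of the vertex v is slack.\<close>
  define good where "good = (\<lambda>es. \<exists>F. finite F \<and> F \<subseteq> strongly_fixed A g \<and>
    (\<forall>fs. (v, es @ fs) \<in> fpaths E \<longrightarrow> (\<exists>\<nu>\<in>F. comparable E (v, es @ fs) \<nu>)))"
  have sf_good: "good es" if "(v, es) \<in> strongly_fixed A g" for es
    unfolding good_def
  proof (intro exI [of _ "{(v, es)}"] conjI allI impI)
    fix fs assume "(v, es @ fs) \<in> fpaths E"
    then show "\<exists>\<nu>\<in>{(v, es)}. comparable E (v, es @ fs) \<nu>"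
      using that by (auto simp: comparable_iff strongly_fixed_iff simp del: fpaths_append)
  qed (use that in auto)
  have "good []"
  proof (rule ccontr)
    assume "\<not> good []"
    have "\<exists>x. \<forall>n. (v, stake n x) \<in> fpaths E \<and> \<not> good (stake n x)"
    proof (rule stream_of_extendable_lists)
      show "(v, []) \<in> fpaths E \<and> \<not> good []" using v \<open>\<not> good []\<close> by simp
    next
      fix es assume es: "(v, es) \<in> fpaths E \<and> \<not> good es"
      let ?w = "psource E (v, es)"
      \<comment> \<open>At a singular vertex the path would be a boundary path, hence strongly fixed
        and good. So a bad path ends at a vertex that receives finitely many edges, at least
        one.\<close>
      have "\<not> singular E ?w"
      proof
        assume "singular E ?w"
        then have "FinPath (v, es) \<in> boundary_paths E" using es by (simp add: boundary_paths_def)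
        then obtain cs where cs: "FinPath (v, es) \<in> cylinder E (v, cs)" "(v, cs) \<in> strongly_fixed A g"
          using prefix_fixed [of "FinPath (v, es)"] by (auto simp: prange_def)
        then have "take (length cs) es = cs"
          using cylinder_iff by (auto simp: strongly_fixed_iff)
        then have "es = cs @ drop (length cs) es" by (metis append_take_drop_id)
        then have "(v, es) \<in> strongly_fixed A g" using strongly_fixed_append cs(2) es by metis
        then show False using sf_good es by blast
      qed
      then have fin: "finite (in_arcs E ?w)" "in_arcs E ?w \<noteq> {}" by (auto simp: singular_def)
      show "\<exists>e. (v, es @ [e]) \<in> fpaths E \<and> \<not> good (es @ [e])"
      proof (rule ccontr)
        assume "\<nexists>e. (v, es @ [e]) \<in> fpaths E \<and> \<not> good (es @ [e])"
        then have "\<forall>e\<in>in_arcs E ?w. good (es @ [e])" using es by auto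
        then obtain F where F: "\<And>e. e \<in> in_arcs E ?w \<Longrightarrow> finite (F e)"
          "\<And>e. e \<in> in_arcs E ?w \<Longrightarrow> F e \<subseteq> strongly_fixed A g"
          "\<And>e fs. e \<in> in_arcs E ?w \<Longrightarrow> (v, (es @ [e]) @ fs) \<in> fpaths E \<Longrightarrow>
             \<exists>\<nu>\<in>F e. comparable E (v, (es @ [e]) @ fs) \<nu>"
          unfolding good_def by metis
        have "good es"
          unfolding good_def
        proof (intro exI [of _ "\<Union>e\<in>in_arcs E ?w. F e"] conjI allI impI)
          fix fs assume fs: "(v, es @ fs) \<in> fpaths E"
          show "\<exists>\<nu>\<in>\<Union>e\<in>in_arcs E ?w. F e. comparable E (v, es @ fs) \<nu>"
          proof (cases fs)
            case Nil
            \<comment> \<open>The path \<open>es\<close> itself is handled through a one-edge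
              extension: a path comparable with \<open>es @ [e]\<close> is comparable with
              \<open>es\<close>.\<close>
            obtain e where e: "e \<in> in_arcs E ?w" using fin by blast
            then have fe: "(v, es @ [e]) \<in> fpaths E" using es by auto
            then obtain \<nu> where \<nu>: "\<nu> \<in> F e" "comparable E (v, es @ [e]) \<nu>"
              using F(3) [OF e, of "[]"] by auto
            then obtain ns where ns: "\<nu> = (v, ns)" "(v, ns) \<in> fpaths E"
              using F(2) [OF e] vg by (cases \<nu>) (auto simp: strongly_fixed_iff)
            then obtain gs where "es @ [e] = ns @ gs \<or> ns = (es @ [e]) @ gs"
              using \<nu> comparable_iff [OF fe] by auto
            then have "\<exists>gs. es = ns @ gs \<or> ns = es @ gs"
              by (cases gs rule: rev_cases) (auto simp flip: append_assoc, metis append_assoc)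
            then have "comparable E (v, es) \<nu>" using es ns by (simp add: comparable_iff)
            then show ?thesis using Nil e \<nu>(1) by auto
          next
            case (Cons e fs')
            then have e: "e \<in> in_arcs E ?w" using fs by auto
            then show ?thesis using F(3) [OF e, of fs'] fs Cons by auto
          qed
        next
          show "finite (\<Union>e\<in>in_arcs E ?w. F e)" using F(1) fin(1) by blast
          show "(\<Union>e\<in>in_arcs E ?w. F e) \<subseteq> strongly_fixed A g" using F(2) by blast
        qed
        then show False using es by blast
      qed
    qed
    then obtain x where x: "\<And>n. (v, stake n x) \<in> fpaths E" "\<And>n. \<not> good (stake n x)" by blast
    have hd: "head E (shd x) = v" using x(1) [of 1] by simp
    then have "InfPath x \<in> boundary_paths E" using x(1) by (simp add: boundary_paths_def inf_paths_iff)
    then obtain cs where cs: "InfPath x \<in> cylinder E (v, cs)" "(v, cs) \<in> strongly_fixed A g"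
      using prefix_fixed [of "InfPath x"] hd by auto
    then have "stake (length cs) x = cs"
      using cylinder_iff by (auto simp: strongly_fixed_iff)
    then show False using x(2) [of "length cs"] sf_good cs(2) by simp
  qed
  then show ?thesis
    unfolding good_def has_slack_def by (auto simp: fpaths_at_iff v_def)
qed

lemma effectiveD:
  assumes "effective \<G>" "(\<alpha>, g, \<beta>, \<xi>) \<in> quads A" "openin (boundary_topology E) V" "\<xi> \<in> V"
    "V \<subseteq> cylinder E \<beta>" "\<And>\<eta>. \<eta> \<in> V \<Longrightarrow> quad_range A (\<alpha>, g, \<beta>, \<eta>) = \<eta>"
  shows "germ A (\<alpha>, g, \<beta>, \<xi>) = unit_germ A \<xi>"
  using assms(1) [unfolded effective_iff, rule_format, OF assms(2-6)] .

text \<open>At an infinite receiver the vertex is a boundary path, and removing the cylinders of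
  finitely many edges leaves an isotropic neighbourhood of it. The vertex has no longer prefix on
  which g could become trivial, so g itself is a unit.\<close>

lemma effective_imp_no_exceptional:
  assumes eff: "effective \<G>" and g: "g \<in> arrows (grp A)"
    and inf: "infinite_receiver E (src (grp A) g)"
    and F: "finite F" "F \<subseteq> {\<mu> \<in> fpaths_at E (src (grp A) g). plength \<mu> = 1}"
    and fixed: "fixes_all_except A g F"
  shows "g \<in> units (grp A)"
proof -
  define v where "v = src (grp A) g"
  have v: "v \<in> verts E" using g src_units units_verts v_def by auto
  have F1: "\<exists>e. \<beta> = (v, [e]) \<and> (v, [e]) \<in> fpaths E" if "\<beta> \<in> F" for \<beta>
  proof -
    have "\<beta> \<in> fpaths_at E v" "plength \<beta> = 1" using F that by (auto simp: v_def)
    then show ?thesis by (auto simp: fpaths_at_iff plength_def length_Suc_conv)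
  qed
  have fx: "rng (grp A) g = v \<and> act_edges A g es = es"
    if "(v, es) \<in> fpaths E" "\<And>\<beta>. \<beta> \<in> F \<Longrightarrow> \<not> extends E (v, es) \<beta>" for es
  proof -
    have "(v, es) \<in> fpaths_at E (src (grp A) g)" using that(1) by (simp add: fpaths_at_iff v_def)
    then have "fixes_path A g (v, es)"
      using fixed that(2) unfolding fixes_all_except_def by blast
    then show ?thesis by (simp add: fixes_path_iff)
  qed
  have vg: "src (grp A) g = v" "rng (grp A) g = v"
  proof -
    \<comment> \<open>Members of F have length one, so the vertex extends none of them and g must
      fix it.\<close>
    have "\<not> extends E (v, []) \<beta>" if "\<beta> \<in> F" for \<beta>
      using F1 [OF that] v by (auto simp: extends_iff)
    then show "src (grp A) g = v" "rng (grp A) g = v"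
      using fx [of "[]"] v v_def by auto
  qed
  define V where "V = (cylinder E (v, []) - (\<Union>\<beta>\<in>F. cylinder E (pconcat (v, []) \<beta>))) \<inter> boundary_paths E"
  let ?\<xi> = "FinPath (v, [])"
  have "F \<subseteq> fpaths_at E (psource E (v, []))" using F(2) by (auto simp: v_def)
  then have V: "openin (boundary_topology E) V" "V \<subseteq> cylinder E (v, [])"
    using openin_boundary_cylinder_minus [of "(v, [])" F] F(1) v by (auto simp: V_def)
  have \<xi>: "?\<xi> \<in> boundary_paths E" "xrange E ?\<xi> = v"
    using v inf by (auto simp: boundary_paths_def singular_def infinite_receiver_def v_def prange_def)
  have "?\<xi> \<notin> cylinder E (pconcat (v, []) \<beta>)" if "\<beta> \<in> F" for \<beta>
    using F1 [OF that] by (auto simp: pconcat_def cylinder_iff)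
  then have \<xi>V: "?\<xi> \<in> V"
    using \<xi> v boundary_paths_xpaths by (auto simp: cylinder_iff V_def)
  have *: "((v, []), g, (v, []), \<eta>) \<in> quads A \<and> quad_range A ((v, []), g, (v, []), \<eta>) = \<eta>"
    if \<eta>: "\<eta> \<in> V" for \<eta>
  proof -
    have bd: "\<eta> \<in> boundary_paths E" "xrange E \<eta> = v" "\<eta> \<in> xpaths E"
      using \<eta> v by (auto simp: cylinder_iff V_def)
    have "act_edges A g (xtake n \<eta>) = xtake n \<eta>" for n
    proof -
      have fp: "(v, xtake n \<eta>) \<in> fpaths E" using xtake_fpaths bd by blast
      have "\<not> extends E (v, xtake n \<eta>) \<beta>" if \<beta>: "\<beta> \<in> F" for \<beta>
      proof
        assume ext: "extends E (v, xtake n \<eta>) \<beta>"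
        obtain e where e: "\<beta> = (v, [e])" "(v, [e]) \<in> fpaths E" using F1 \<beta> by blast
        then obtain gs where gs: "xtake n \<eta> = e # gs" using ext extends_iff [OF fp] by auto
        then have "1 \<le> n" using length_xtake_le [of n \<eta>] by simp
        then have "xtake 1 \<eta> = [e]" using take_xtake [of 1 n \<eta>] gs by simp
        then have "\<eta> \<in> cylinder E (pconcat (v, []) \<beta>)"
          using e bd by (simp add: pconcat_def cylinder_iff)
        then show False using \<eta> \<beta> unfolding V_def by blast
      qed
      then show ?thesis using fx [OF fp] by simp
    qed
    then show ?thesis
      using fixed_quad [OF g vg bd(1,2)] quad_range_fixed_quad [OF g vg bd(1,2)] by auto
  qed
  then have q: "((v, []), g, (v, []), ?\<xi>) \<in> quads A" using \<xi>V by simp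
  have "germ A ((v, []), g, (v, []), ?\<xi>) = unit_germ A ?\<xi>"
    by (rule effectiveD [OF eff q V(1) \<xi>V V(2)]) (use * in simp)
  then obtain cs where cs: "(v, cs) \<in> fpaths E" "?\<xi> \<in> cylinder E (v, cs)"
    "res_edges A g cs = psource E (v, cs)"
    unfolding germ_eq_unit_germ_iff [OF q] by auto
  then have "cs = []" by (simp add: cylinder_iff)
  then have "g = v" using cs by simp
  then show ?thesis using v units_verts by simp
qed

text \<open>Without an entrance a path at v can only follow \<open>es\<close>, and g carries its
  continuation at s(g) back to v, so v has exactly one path of each length and one boundary path. A
  germ with prefixes \<open>es\<close> and v is then isotropic on an open set, but its prefixes
  differ in length.\<close>

lemma effective_imp_Cyc:
  assumes eff: "effective \<G>"
  shows "cond_Cyc A"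
  unfolding cond_Cyc_def
proof (intro ballI impI, rule ccontr)
  fix g \<alpha>
  assume g: "g \<in> arrows (grp A)" and "\<alpha> \<in> fpaths E"
    and "1 \<le> plength \<alpha> \<and> psource E \<alpha> = src (grp A) g \<and> prange \<alpha> = rng (grp A) g"
    and "\<not> has_entrance E \<alpha>"
  then obtain v es where es: "(v, es) \<in> fpaths E" "es \<noteq> []" "psource E (v, es) = src (grp A) g"
    "rng (grp A) g = v" and ne: "\<not> has_entrance E (v, es)"
    by (cases \<alpha>; cases "snd \<alpha> = []") (auto simp: plength_def prange_def)
  obtain h where h: "h \<in> arrows (grp A)" "src (grp A) h = v" "rng (grp A) h = src (grp A) g"
    "\<And>es. (src (grp A) g, es) \<in> fpaths E \<Longrightarrow> act_edges A h (act_edges A g es) = es"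
    using inverse_action [OF g] es(4) by metis
  have v: "v \<in> verts E" using es(1) fpaths_verts by blast
  \<comment> \<open>The range of each edge of \<open>es\<close> receives no other edge, so a path at
    v cannot leave \<open>es\<close> before its end.\<close>
  have short: "take (length ts) es = ts" if "(v, ts) \<in> fpaths E" "length ts \<le> length es" for ts
    using that
  proof (induction ts rule: rev_induct)
    case (snoc t us)
    have fp: "(v, us) \<in> fpaths E" and t: "t \<in> in_arcs E (psource E (v, us))"
      and len: "length us < length es"
      using snoc.prems by auto
    have us: "take (length us) es = us" using snoc.IH [OF fp] len by simp
    let ?f = "es ! length us"
    have "us @ ?f # drop (Suc (length us)) es = es"
      using id_take_nth_drop [OF len] unfolding us by (rule sym)
    then have "(v, us @ ?f # drop (Suc (length us)) es) \<in> fpaths E" using es(1) by (rule ssubst)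
    then have f: "?f \<in> in_arcs E (psource E (v, us))" by simp
    have "psource E (v, us) = head E ?f" using f by simp
    then have "psource E (v, us) \<in> head E ` set es" using nth_mem [OF len] by (rule image_eqI)
    then have "t = ?f" using ne t f unfolding has_entrance_def snd_conv by blast
    then show ?case using take_Suc_conv_app_nth [OF len] us by simp
  qed simp
  \<comment> \<open>Beyond \<open>es\<close> the tails have range s(g); g carries them to strictly
    shorter paths at v, and injectivity of g finishes the induction.\<close>
  have unique: "ts = ts'" if "(v, ts) \<in> fpaths E" "(v, ts') \<in> fpaths E" "length ts' = length ts" for ts ts'
    using that
  proof (induction "length ts" arbitrary: ts ts' rule: less_induct)
    case less
    show ?case
    proof (cases "length ts \<le> length es")
      case True
      then show ?thesis
        using short [OF less.prems(1)] short [OF less.prems(2)] unfolding less.prems(3) by metis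
    next
      case False
      have split: "\<exists>us. es @ us = rs \<and> (src (grp A) g, us) \<in> fpaths E"
        if rs: "(v, rs) \<in> fpaths E" "length rs > length es" for rs
      proof -
        have "(v, take (length es) rs @ drop (length es) rs) \<in> fpaths E" using rs(1) by simp
        then have fp: "(v, take (length es) rs) \<in> fpaths E"
          "(psource E (v, take (length es) rs), drop (length es) rs) \<in> fpaths E"
          unfolding fpaths_append by blast+
        have len: "length (take (length es) rs) = length es" using rs(2) by simp
        have t: "take (length es) rs = es"
          using short [OF fp(1)] unfolding len by (metis order_refl take_all)
        show ?thesis
          using fp(2) append_take_drop_id [of "length es" rs] unfolding t es(3) by blast
      qed
      obtain us us' where us: "es @ us = ts" "(src (grp A) g, us) \<in> fpaths E"
          "es @ us' = ts'" "(src (grp A) g, us') \<in> fpaths E"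
        using split [OF less.prems(1)] split [OF less.prems(2)] False
        unfolding less.prems(3) not_le by blast
      have len: "length us' = length us" "length us < length ts"
        using less.prems(3) es(2) unfolding us(1,3) [symmetric] by auto
      have fp: "(v, act_edges A g us) \<in> fpaths E" "(v, act_edges A g us') \<in> fpaths E"
        using act_edges_fpaths [OF g us(2)] act_edges_fpaths [OF g us(4)] unfolding es(4) .
      have "act_edges A g us = act_edges A g us'"
        by (rule less.hyps [OF _ fp]) (simp_all add: len)
      then have "us = us'" by (metis h(4) us(2,4))
      then show ?thesis unfolding us(1) [symmetric] us(3) [symmetric] by (rule arg_cong)
    qed
  qed
  have long: "\<exists>ts. (v, ts) \<in> fpaths E \<and> length ts = n" for n
  proof (induction n)
    case 0
    then show ?case using v by auto
  next
    case (Suc n)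
    then obtain ts where ts: "(v, ts) \<in> fpaths E" "length ts = n" by blast
    \<comment> \<open>The inverse \<open>h\<close> moves a path at v behind \<open>es\<close>, which
      adds at least one edge; the surplus is cut off.\<close>
    let ?us = "es @ act_edges A h ts"
    have "(src (grp A) g, act_edges A h ts) \<in> fpaths E"
      using act_edges_fpaths [OF h(1), of ts] ts(1) unfolding h(2,3) by blast
    then have "(v, ?us) \<in> fpaths E" using es(1,3) by simp
    then have "(v, take (Suc n) ?us @ drop (Suc n) ?us) \<in> fpaths E"
      unfolding append_take_drop_id .
    then have "(v, take (Suc n) ?us) \<in> fpaths E" unfolding fpaths_append by blast
    moreover have "length (take (Suc n) ?us) = Suc n"
    proof -
      obtain k where "length es = Suc k" using es(2) by (cases es) auto
      then show ?thesis using ts(2) by (auto simp: min_def)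
    qed
    ultimately show ?case by blast
  qed
  \<comment> \<open>By uniqueness the path with one more edge starts with \<open>ts\<close>, and its
    last edge is the only one that can follow \<open>ts\<close>.\<close>
  have regular: "\<not> singular E (psource E (v, ts))" if ts: "(v, ts) \<in> fpaths E" for ts
  proof -
    obtain us where us: "(v, us) \<in> fpaths E" "length us = Suc (length ts)" using long by blast
    then obtain rs e where "us = rs @ [e]" by (metis length_Suc_conv_rev)
    then have "(v, ts @ [e]) \<in> fpaths E" using us unique [of ts rs] ts by auto
    then have e: "e \<in> in_arcs E (psource E (v, ts))" by simp
    have "f = e" if "f \<in> in_arcs E (psource E (v, ts))" for f
      using unique [of "ts @ [e]" "ts @ [f]"] that e ts by (auto simp: tail_in_verts)
    then have "in_arcs E (psource E (v, ts)) = {e}" using e by blast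
    then show ?thesis by (simp add: singular_def)
  qed
  \<comment> \<open>A boundary path at v cannot end at a regular vertex, so it is infinite.\<close>
  have len: "length (xtake n \<xi>) = n" if \<xi>: "\<xi> \<in> boundary_paths E" "xrange E \<xi> = v" for n \<xi>
  proof (cases \<xi>)
    case (FinPath \<mu>)
    obtain ts where ts: "\<mu> = (v, ts)"
      using \<xi>(2) unfolding FinPath xrange.simps prange_def by (cases \<mu>) simp
    have "\<mu> \<in> fpaths E \<and> singular E (psource E \<mu>)"
      using \<xi>(1) unfolding FinPath boundary_paths_def by blast
    then show ?thesis using regular [of ts] unfolding ts by blast
  qed simp
  have single: "\<xi> = \<eta>" if \<xi>: "\<xi> \<in> boundary_paths E" "xrange E \<xi> = v"
    and \<eta>: "\<eta> \<in> boundary_paths E" "xrange E \<eta> = v" for \<xi> \<eta>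
  proof (rule xpath_eqI)
    show "xrange E \<xi> = xrange E \<eta>" unfolding \<xi>(2) \<eta>(2) by (rule refl)
    have "xtake n \<xi> = xtake n \<eta>" for n
    proof (rule unique)
      show "(v, xtake n \<xi>) \<in> fpaths E" "(v, xtake n \<eta>) \<in> fpaths E"
        using xtake_fpaths [OF subsetD [OF boundary_paths_xpaths \<xi>(1)], of n]
          xtake_fpaths [OF subsetD [OF boundary_paths_xpaths \<eta>(1)], of n]
        unfolding \<xi>(2) \<eta>(2) .
      show "length (xtake n \<eta>) = length (xtake n \<xi>)" unfolding len [OF \<xi>] len [OF \<eta>] by (rule refl)
    qed
    then show "\<exists>a\<ge>m. \<exists>b\<ge>m. xtake a \<xi> = xtake b \<eta>" for m by blast
  qed
  define V where "V = cylinder E (v, []) \<inter> boundary_paths E"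
  have V: "openin (boundary_topology E) V" "V \<subseteq> cylinder E (v, [])"
    using openin_boundary_cylinder [of "(v, [])"] v by (auto simp: V_def)
  obtain \<xi> where \<xi>: "\<xi> \<in> V" using boundary_extension [of v "[]"] v by (auto simp: V_def)
  have quad: "((v, es), h, (v, []), \<eta>) \<in> quads A" if "\<eta> \<in> V" for \<eta>
    using that es h v by (simp add: quads_def V_def)
  have range: "quad_range A ((v, es), h, (v, []), \<eta>) = \<eta>" if \<eta>: "\<eta> \<in> V" for \<eta>
  proof (rule single)
    show "\<eta> \<in> boundary_paths E" "xrange E \<eta> = v"
      using \<eta> v by (auto simp: cylinder_iff V_def)
    show "quad_range A ((v, es), h, (v, []), \<eta>) \<in> boundary_paths E"
      using quad [OF \<eta>] by (rule quad_range_boundary)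
    show "xrange E (quad_range A ((v, es), h, (v, []), \<eta>)) = v"
      unfolding xrange_quad_range [OF quad [OF \<eta>]] by simp
  qed
  have "germ A ((v, es), h, (v, []), \<xi>) = unit_germ A \<xi>"
    using eff quad [OF \<xi>] V(1) \<xi> V(2) range by (rule effectiveD)
  \<comment> \<open>The action keeps the length of \<open>cs\<close>, so \<open>es\<close> would
    have to be empty.\<close>
  then obtain cs where "es @ act_edges A h cs = cs"
    unfolding germ_eq_unit_germ_iff [OF quad [OF \<xi>]] by auto
  then have "length es + length cs = length cs" by (metis length_act_edges length_append)
  then show False using es(2) by simp
qed

end


section \<open>From isotropy on a neighbourhood to units, at infinite and at finite boundary
  paths\<close>

section \<open>Sufficiency of the conditions\<close>

context self_similar_action
begin

text \<open>An entrance along the path gives a second edge by which a boundary path leaves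
  \<open>es\<close>. An entrance at s(g) is carried by g to r(g), where \<open>es\<close> begins,
  and one of the two image edges differs from the first edge of \<open>es\<close>.\<close>

lemma Cyc_avoids:
  assumes Cyc: "cond_Cyc A" and g: "g \<in> arrows (grp A)" "(rng (grp A) g, es) \<in> fpaths E"
    "psource E (rng (grp A) g, es) = src (grp A) g" "es \<noteq> []"
  shows "\<exists>\<eta>\<in>boundary_paths E. xrange E \<eta> = rng (grp A) g \<and> xtake (length es) \<eta> \<noteq> es"
proof -
  let ?v = "rng (grp A) g"
  \<comment> \<open>Follow \<open>es\<close> for \<open>i\<close> edges, take the other edge
    \<open>e\<close>, and prolong to a boundary path.\<close>
  have branch: ?thesis if i: "i < length es" and e: "e \<in> in_arcs E (head E (es ! i))" "e \<noteq> es ! i" for i e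
  proof -
    have "(?v, take i es @ es ! i # drop (Suc i) es) \<in> fpaths E"
      unfolding id_take_nth_drop [OF i, symmetric] using g(2) .
    then have fp: "(?v, take i es @ [e]) \<in> fpaths E" using e by (auto simp: tail_in_verts)
    then obtain \<eta> where \<eta>: "\<eta> \<in> boundary_paths E" "\<eta> \<in> cylinder E (?v, take i es @ [e])"
      using boundary_extension by blast
    have len: "length (take i es @ [e]) = Suc i" using i by simp
    have xt: "xrange E \<eta> = ?v" "xtake (Suc i) \<eta> = take i es @ [e]"
      using \<eta>(2) unfolding cylinder_iff [OF fp] len by auto
    have "xtake (length es) \<eta> \<noteq> es"
    proof
      assume "xtake (length es) \<eta> = es"
      then have "take (Suc i) es = take i es @ [e]"
        using take_xtake [of "Suc i" "length es" \<eta>] i xt(2) by simp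
      then show False using e(2) take_Suc_conv_app_nth [OF i] by simp
    qed
    then show ?thesis using \<eta>(1) xt(1) by blast
  qed
  have "has_entrance E (?v, es)"
  proof -
    have "plength (?v, es) \<ge> 1" using g(4) by (cases es) (auto simp: plength_def)
    then show ?thesis using Cyc g unfolding cond_Cyc_def by (simp add: prange_def)
  qed
  then obtain w e f where w: "w \<in> head E ` set es \<union> {src (grp A) g}"
    and ef: "e \<in> in_arcs E w" "f \<in> in_arcs E w" "e \<noteq> f"
    unfolding has_entrance_def snd_conv g(3) by blast
  show ?thesis
  proof (cases "w \<in> head E ` set es")
    case True
    then obtain i where i: "i < length es" "w = head E (es ! i)" by (auto simp: in_set_conv_nth)
    show ?thesis
    proof (cases "e = es ! i")
      case True
      then show ?thesis using branch [of i f] i ef by metis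
    next
      case False
      then show ?thesis using branch [of i e] i ef by metis
    qed
  next
    case False
    then have "w = src (grp A) g" using w by blast
    then have "act A g e \<in> in_arcs E ?v" "act A g f \<in> in_arcs E ?v" "act A g e \<noteq> act A g f"
      using ef bij_betw_act [OF g(1)] by (auto simp: bij_betw_def inj_on_def)
    moreover have "0 < length es" "head E (es ! 0) = ?v"
      using g(2,4) by (cases es; simp)+
    ultimately show ?thesis
      using branch [of 0 "act A g e"] branch [of 0 "act A g f"] by metis
  qed
qed

text \<open>Comparing truncations, the longer of the two paths is the shorter one followed by some
  \<open>cs\<close>, and every boundary path at the range of \<open>cs\<close> begins with
  \<open>cs\<close>, against \<open>Cyc_avoids\<close>. For equal lengths the paths coincide, and g
  fixes every finite path because it is a prefix of a boundary path.\<close>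

lemma isotropic_cylinder:
  assumes Cyc: "cond_Cyc A" and g: "g \<in> arrows (grp A)"
    and as: "(a, as) \<in> fpaths E" "rng (grp A) g = psource E (a, as)"
    and bs: "(b, bs) \<in> fpaths E" "src (grp A) g = psource E (b, bs)"
    and iso: "\<And>\<eta>. \<eta> \<in> boundary_paths E \<Longrightarrow> xrange E \<eta> = src (grp A) g \<Longrightarrow>
      xconcat (a, as) (act_xpath A g \<eta>) = xconcat (b, bs) \<eta>"
  shows "(a, as) = (b, bs)" "\<forall>\<mu>\<in>fpaths_at E (src (grp A) g). fixes_path A g \<mu>"
proof -
  let ?v = "src (grp A) g"
  have v: "?v \<in> verts E" using psource_verts bs by simp
  have at: "\<eta> \<in> xpaths_at E ?v" if "\<eta> \<in> boundary_paths E" "xrange E \<eta> = ?v" for \<eta>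
    using that boundary_paths_xpaths by (auto simp: xpaths_at_def)
  have eq: "take n as @ act_edges A g (xtake (n - length as) \<eta>) = take n bs @ xtake (n - length bs) \<eta>"
    if "\<eta> \<in> boundary_paths E" "xrange E \<eta> = ?v" for n \<eta>
    using arg_cong [OF iso [OF that], of "xtake n"] by (simp add: xtake_xconcat xtake_act_xpath)
  have x0: "xtake 0 \<eta> = []" for \<eta> :: "('g, 'e) xpath" by (cases \<eta>) auto
  obtain \<zeta> where \<zeta>: "\<zeta> \<in> boundary_paths E" "xrange E \<zeta> = ?v"
    using boundary_extension [of ?v "[]"] v by (auto simp: cylinder_iff)
  have ab: "a = b"
  proof -
    have "xrange E (xconcat (a, as) (act_xpath A g \<zeta>)) = a"
      using xrange_xconcat [OF as(1)] act_xpath_at [OF g at [OF \<zeta>]] as(2) by simp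
    moreover have "xrange E (xconcat (b, bs) \<zeta>) = b"
      using xrange_xconcat [OF bs(1)] at [OF \<zeta>] bs(2) by simp
    ultimately show ?thesis using iso [OF \<zeta>] by simp
  qed
  have "length as \<le> length bs"
  proof (rule ccontr)
    assume "\<not> length as \<le> length bs"
    then have len: "length bs < length as" by simp
    define cs where "cs = drop (length bs) as"
    have cs: "take (length bs) as = bs"
      using eq [OF \<zeta>, of "length bs"] len by (simp add: x0)
    then have as_eq: "bs @ cs = as" unfolding cs_def by (metis append_take_drop_id)
    have fixed: "xtake (length cs) \<eta> = cs" if "\<eta> \<in> boundary_paths E" "xrange E \<eta> = ?v" for \<eta>
    proof -
      have "as = bs @ xtake (length as - length bs) \<eta>"
        using eq [OF that, of "length as"] len by (simp add: x0)
      moreover have "length as - length bs = length cs" by (simp add: cs_def)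
      ultimately show ?thesis using as_eq by (metis same_append_eq)
    qed
    \<comment> \<open>\<open>cs\<close> has range s(g) and source r(g), so (Cyc) is applied to an
      inverse of g.\<close>
    obtain h where h: "h \<in> arrows (grp A)" "src (grp A) h = rng (grp A) g" "rng (grp A) h = ?v"
      using inverse_action [OF g] by metis
    have "(b, bs @ cs) \<in> fpaths E" "psource E (b, bs @ cs) = rng (grp A) g"
      unfolding as_eq using as ab by auto
    then have "(?v, cs) \<in> fpaths E" "psource E (?v, cs) = rng (grp A) g"
      using bs(2) by auto
    moreover have "cs \<noteq> []" using len by (simp add: cs_def)
    ultimately show False
      using Cyc_avoids [OF Cyc h(1), of cs] fixed h by auto
  qed
  moreover have "length bs \<le> length as"
  proof (rule ccontr)
    assume "\<not> length bs \<le> length as"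
    then have len: "length as < length bs" by simp
    define cs where "cs = drop (length as) bs"
    have cs: "take (length as) bs = as"
      using eq [OF \<zeta>, of "length as"] len by (simp add: x0)
    then have bs_eq: "as @ cs = bs" unfolding cs_def by (metis append_take_drop_id)
    have fixed: "act_edges A g (xtake (length cs) \<eta>) = cs"
      if "\<eta> \<in> boundary_paths E" "xrange E \<eta> = ?v" for \<eta>
    proof -
      have "as @ act_edges A g (xtake (length bs - length as) \<eta>) = bs"
        using eq [OF that, of "length bs"] len by (simp add: x0)
      moreover have "length bs - length as = length cs" by (simp add: cs_def)
      ultimately show ?thesis using bs_eq by (metis same_append_eq)
    qed
    have "(b, as @ cs) \<in> fpaths E" "psource E (b, as @ cs) = ?v"
      unfolding bs_eq using bs by auto
    then have "(rng (grp A) g, cs) \<in> fpaths E" "psource E (rng (grp A) g, cs) = ?v"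
      using as(2) ab by auto
    moreover have "cs \<noteq> []" using len by (simp add: cs_def)
    ultimately obtain \<eta> where \<eta>: "\<eta> \<in> boundary_paths E" "xrange E \<eta> = rng (grp A) g"
      "xtake (length cs) \<eta> \<noteq> cs"
      using Cyc_avoids [OF Cyc g, of cs] by auto
    then have "\<eta> \<in> xpaths_at E (rng (grp A) g)"
      using boundary_paths_xpaths by (auto simp: xpaths_at_def)
    \<comment> \<open>Only paths of the form g\<xi> are known to begin with \<open>cs\<close>;
      surjectivity of g brings \<eta> into this form.\<close>
    then obtain \<xi> where "\<xi> \<in> xpaths_at E ?v" "\<xi> \<in> boundary_paths E" "act_xpath A g \<xi> = \<eta>"
      using act_xpath_surj [OF g] \<eta>(1) by blast
    then show False
      using fixed [of \<xi>] \<eta>(3) xtake_act_xpath [of "length cs" A g \<xi>] by (simp add: xpaths_at_def)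
  qed
  ultimately have len: "length as = length bs" by simp
  have asbs: "as = bs"
    using eq [OF \<zeta>, of "length bs"] len by (simp add: x0)
  then show "(a, as) = (b, bs)" using ab by simp
  have "fixes_path A g (?v, es)" if es: "(?v, es) \<in> fpaths E" for es
  proof -
    obtain \<eta> where "\<eta> \<in> boundary_paths E" "\<eta> \<in> cylinder E (?v, es)"
      using boundary_extension [OF es] by blast
    then have \<eta>: "\<eta> \<in> boundary_paths E" "xrange E \<eta> = ?v" "xtake (length es) \<eta> = es"
      using cylinder_iff [OF es] by auto
    have "act_edges A g es = es"
      using eq [OF \<eta>(1,2), of "length bs + length es"] asbs \<eta>(3) by simp
    then show ?thesis using as(2) bs(2) ab asbs by (simp add: fixes_path_iff)
  qed
  then show "\<forall>\<mu>\<in>fpaths_at E ?v. fixes_path A g \<mu>" by (auto simp: fpaths_at_iff)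
qed

text \<open>Moving a further piece \<open>cs\<close> of \<xi> into \<beta> gives another
  representative of the same germ: the witnesses are \<open>cs\<close> on one side and the empty
  path on the other.\<close>

lemma quad_shift:
  assumes q: "((a, as), g, (b, bs), \<xi>) \<in> quads A"
    and cyl: "(b, bs @ cs) \<in> fpaths E" "\<xi> \<in> cylinder E (b, bs @ cs)"
  defines "q' \<equiv> ((a, as @ act_edges A g cs), res_edges A g cs, (b, bs @ cs), \<xi>)"
  shows quad_shift_quad: "q' \<in> quads A"
    and germ_quad_shift: "germ A q' = germ A ((a, as), g, (b, bs), \<xi>)"
    and quad_range_shift: "quad_range A q' = quad_range A ((a, as), g, (b, bs), \<xi>)"
proof -
  have Q: "(a, as) \<in> fpaths E" "(b, bs) \<in> fpaths E" "g \<in> arrows (grp A)" "\<xi> \<in> boundary_paths E"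
    "rng (grp A) g = psource E (a, as)" "src (grp A) g = psource E (b, bs)"
    using q by (auto simp: quads_def)
  have cs: "(src (grp A) g, cs) \<in> fpaths E" using cyl Q by simp
  show q': "q' \<in> quads A"
    using Q cyl act_edges_fpaths [OF Q(3) cs] res_edges_arrows [OF Q(3) cs]
      src_res_edges [OF Q(3) cs] rng_res_edges [OF Q(3) cs]
    by (simp add: quads_def q'_def)
  have "(((a, as), g, (b, bs), \<xi>), q') \<in> germ_rel A"
  proof -
    have "\<exists>es. (psource E (b, bs), es) \<in> fpaths E \<and> (\<exists>fs. (psource E (b, bs @ cs), fs) \<in> fpaths E \<and>
        bs @ es = (bs @ cs) @ fs \<and> \<xi> \<in> cylinder E (b, bs @ es) \<and>
        as @ act_edges A g es = (as @ act_edges A g cs) @ act_edges A (res_edges A g cs) fs \<and>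
        res_edges A g es = res_edges A (res_edges A g cs) fs)"
      using cyl psource_verts [OF cyl(1)] by (intro exI [of _ cs] exI [of _ "[]"] conjI) auto
    then show ?thesis
      using q q' by (simp add: germ_rel_def q'_def bex_fpaths_at pconcat_def act_path_def res_path_def)
  qed
  then show "germ A q' = germ A ((a, as), g, (b, bs), \<xi>)"
    "quad_range A q' = quad_range A ((a, as), g, (b, bs), \<xi>)"
    using germ_eq_iff [OF q q'] quad_range_cong by metis+
qed

text \<open>Cut \<xi> at a bound for the lengths in the finite set given by slack: a member
  comparable with that truncation must be a prefix of it. The hypothesis \<open>len\<close> says
  that \<xi> is infinite.\<close>

lemma slack_prefix:
  assumes "has_slack A g" "\<xi> \<in> xpaths E" "xrange E \<xi> = src (grp A) g"
    and len: "\<And>n. length (xtake n \<xi>) = n"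
  shows "\<exists>cs. \<xi> \<in> cylinder E (src (grp A) g, cs) \<and> (src (grp A) g, cs) \<in> strongly_fixed A g"
proof -
  let ?v = "src (grp A) g"
  obtain F where F: "finite F" "F \<subseteq> strongly_fixed A g"
    "\<And>\<mu>. \<mu> \<in> fpaths_at E ?v \<Longrightarrow> \<exists>\<nu>\<in>F. comparable E \<mu> \<nu>"
    using assms(1) unfolding has_slack_def by blast
  obtain m where m: "\<And>\<nu>. \<nu> \<in> F \<Longrightarrow> length (snd \<nu>) \<le> m"
    using F(1) finite_nat_set_iff_bounded_le [of "(\<lambda>\<nu>. length (snd \<nu>)) ` F"] by auto
  have fp: "(?v, xtake m \<xi>) \<in> fpaths E" using xtake_fpaths [OF assms(2)] assms(3) by metis
  then have "(?v, xtake m \<xi>) \<in> fpaths_at E ?v" by (simp add: fpaths_at_iff)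
  then obtain \<nu> where \<nu>: "\<nu> \<in> F" "comparable E (?v, xtake m \<xi>) \<nu>"
    using F(3) by blast
  then obtain cs where cs: "\<nu> = (?v, cs)" "(?v, cs) \<in> strongly_fixed A g"
    using F(2) by (cases \<nu>) (auto simp: strongly_fixed_iff)
  then have cs_fp: "(?v, cs) \<in> fpaths E" by (simp add: strongly_fixed_iff)
  obtain gs where gs: "xtake m \<xi> = cs @ gs \<or> cs = xtake m \<xi> @ gs"
    using \<nu>(2) comparable_iff [OF fp cs_fp] cs(1) by auto
  have cs_m: "length cs \<le> m" using m [OF \<nu>(1)] cs(1) by simp
  have "take (length cs) (xtake m \<xi>) = cs"
    using gs
  proof
    assume *: "cs = xtake m \<xi> @ gs"
    then have "gs = []" using cs_m len [of m] by simp
    then show ?thesis using * by simp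
  qed simp
  then have "xtake (length cs) \<xi> = cs" using take_xtake [OF cs_m] by metis
  then have "\<xi> \<in> cylinder E (?v, cs)" using assms(2,3) cylinder_iff [OF cs_fp] by simp
  then show ?thesis using cs(2) by blast
qed

text \<open>Lengthening \<beta> along \<open>x\<close> until its whole boundary cylinder lies in
  \<open>V\<close> brings the germ into the form of \<open>isotropic_cylinder\<close>. Then (Slack)
  provides a strongly fixed prefix of the remaining path, beyond which the germ is a unit.\<close>

lemma unit_of_infinite:
  assumes Cyc: "cond_Cyc A" and Slack: "cond_Slack A"
    and q: "(\<alpha>, g, \<beta>, InfPath x) \<in> quads A"
    and V: "openin (boundary_topology E) V" "InfPath x \<in> V"
    and iso: "\<And>\<eta>. \<eta> \<in> V \<Longrightarrow> quad_range A (\<alpha>, g, \<beta>, \<eta>) = \<eta>"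
  shows "germ A (\<alpha>, g, \<beta>, InfPath x) = unit_germ A (InfPath x)"
proof -
  let ?\<xi> = "InfPath x :: ('g, 'e) xpath"
  obtain a as where \<alpha>: "\<alpha> = (a, as)" by force
  obtain b bs where \<beta>: "\<beta> = (b, bs)" by force
  note q = q [unfolded \<alpha> \<beta>]
  have Q: "(b, bs) \<in> fpaths E" "?\<xi> \<in> boundary_paths E" "?\<xi> \<in> cylinder E (b, bs)"
    using q by (auto simp: quads_def)
  then have xp: "?\<xi> \<in> xpaths E" and b: "xrange E ?\<xi> = b" and pre: "xtake (length bs) ?\<xi> = bs"
    using cylinder_iff [OF Q(1)] by auto
  have fp: "(b, stake n x) \<in> fpaths E" for n
    using xtake_fpaths [OF xp, of n] unfolding b by simp
  obtain n where n: "cylinder E (b, stake n x) \<inter> boundary_paths E \<subseteq> V"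
    using openin_boundary_nhd_infinite [OF V] b by auto
  \<comment> \<open>The length \<open>n + length bs\<close> lies past both \<beta> and the threshold
    n of the neighbourhood.\<close>
  define cs where "cs = drop (length bs) (stake (n + length bs) x)"
  have st: "stake (n + length bs) x = bs @ cs"
    using drop_xtake [OF Q(1,3), of "n + length bs"] unfolding cs_def by simp
  have fpc: "(b, bs @ cs) \<in> fpaths E" using fp [of "n + length bs"] unfolding st .
  have len: "length (bs @ cs) = n + length bs" unfolding st [symmetric] by simp
  have \<xi>c: "?\<xi> \<in> cylinder E (b, bs @ cs)"
    using xp b unfolding cylinder_iff [OF fpc] len by (simp add: st)
  have sub: "\<eta> \<in> V" if "\<eta> \<in> cylinder E (b, bs @ cs)" "\<eta> \<in> boundary_paths E" for \<eta>
  proof -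
    have "xtake (n + length bs) \<eta> = stake (n + length bs) x" "\<eta> \<in> xpaths E" "xrange E \<eta> = b"
      using that(1) unfolding cylinder_iff [OF fpc] len st by auto
    then have "\<eta> \<in> cylinder E (b, stake n x)"
      using take_xtake [of n "n + length bs" \<eta>] unfolding cylinder_iff [OF fp]
      by (simp add: take_stake)
    then show ?thesis using n that(2) by blast
  qed
  define as' h where "as' = as @ act_edges A g cs" and "h = res_edges A g cs"
  have q': "((a, as'), h, (b, bs @ cs), ?\<xi>) \<in> quads A"
    unfolding as'_def h_def by (rule quad_shift_quad [OF q fpc \<xi>c])
  have H: "h \<in> arrows (grp A)" "(a, as') \<in> fpaths E" "rng (grp A) h = psource E (a, as')"
    "src (grp A) h = psource E (b, bs @ cs)"
    using q' unfolding quads_def by auto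
  \<comment> \<open>Every boundary path at s(h) gives a point of \<open>V\<close>, so isotropy on
    \<open>V\<close> becomes an equation for all of them.\<close>
  have iso': "xconcat (a, as') (act_xpath A h \<eta>) = xconcat (b, bs @ cs) \<eta>"
    if \<eta>: "\<eta> \<in> boundary_paths E" "xrange E \<eta> = src (grp A) h" for \<eta>
  proof -
    have at: "\<eta> \<in> xpaths_at E (psource E (b, bs @ cs))"
      using \<eta> boundary_paths_xpaths H(4) by (auto simp: xpaths_at_def)
    let ?\<zeta> = "xconcat (b, bs @ cs) \<eta>"
    have \<zeta>: "?\<zeta> \<in> cylinder E (b, bs @ cs)" "?\<zeta> \<in> boundary_paths E"
      using at \<eta>(1) xconcat_boundary_iff [OF fpc at] unfolding cylinder_def by auto
    have "?\<zeta> \<in> cylinder E (b, bs)"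
      using \<zeta>(1) take_xtake [of "length bs" "length (bs @ cs)" ?\<zeta>]
      unfolding cylinder_iff [OF fpc] cylinder_iff [OF Q(1)] by simp
    then have "((a, as), g, (b, bs), ?\<zeta>) \<in> quads A"
      using q \<zeta>(2) by (simp add: quads_def)
    then have "quad_range A ((a, as'), h, (b, bs @ cs), ?\<zeta>) = ?\<zeta>"
      using quad_range_shift [OF _ fpc \<zeta>(1)] iso [OF sub [OF \<zeta>], unfolded \<alpha> \<beta>]
      unfolding as'_def h_def by metis
    then show ?thesis by (simp add: xremainder_xconcat [OF at])
  qed
  note core = isotropic_cylinder [OF Cyc H(1,2,3) fpc H(4) iso']
  have "has_slack A h" using Slack core(2) H(1) unfolding cond_Slack_def by blast
  obtain \<eta> where \<eta>: "\<eta> \<in> xpaths_at E (src (grp A) h)" "\<eta> \<in> boundary_paths E"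
    "?\<xi> = xconcat (b, bs @ cs) \<eta>"
    using quad_remainder [OF q'] by metis
  \<comment> \<open>The remainder stays infinite, as \<open>slack_prefix\<close> requires.\<close>
  then obtain y where y: "\<eta> = InfPath y" by (cases \<eta>) auto
  obtain ds where ds: "\<eta> \<in> cylinder E (src (grp A) h, ds)" "(src (grp A) h, ds) \<in> strongly_fixed A h"
    using slack_prefix [OF \<open>has_slack A h\<close>, of \<eta>] \<eta>(1) y by (auto simp: xpaths_at_def)
  have D: "(src (grp A) h, ds) \<in> fpaths E" "act_edges A h ds = ds"
    "res_edges A h ds = psource E (src (grp A) h, ds)"
    using ds(2) by (auto simp: strongly_fixed_iff)
  have fpd: "(b, (bs @ cs) @ ds) \<in> fpaths E"
    using fpc D(1) H(4) unfolding fpaths_append [of b "bs @ cs" ds] by simp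
  have "xtake (length ds) \<eta> = ds" using ds(1) unfolding cylinder_iff [OF D(1)] by blast
  then have "xtake (length ((bs @ cs) @ ds)) (xconcat (b, bs @ cs) \<eta>) = (bs @ cs) @ ds"
    by (simp add: xtake_xconcat)
  then have "xtake (length ((bs @ cs) @ ds)) ?\<xi> = (bs @ cs) @ ds"
    unfolding \<eta>(3) .
  then have "?\<xi> \<in> cylinder E (b, (bs @ cs) @ ds)"
    using xp b unfolding cylinder_iff [OF fpd] by blast
  then have "germ A ((a, as'), h, (b, bs @ cs), ?\<xi>) = unit_germ A ?\<xi>"
    unfolding germ_eq_unit_germ_iff [OF q'] using core(1) fpd D H(4)
    by (intro exI [of _ ds]) simp
  then show ?thesis
    using germ_quad_shift [OF q fpc \<xi>c] unfolding \<alpha> \<beta> as'_def h_def by simp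
qed

text \<open>With \<beta> lengthened to all of \<xi>, isotropy at \<xi> itself makes the two prefixes
  equal. The singular vertex s(h) either receives no edge, where (Slack) applies, or is an infinite
  receiver, where the excluded edges form the finite exceptional set.\<close>

lemma unit_of_finite:
  assumes Slack: "cond_Slack A"
    and no_exceptional: "\<And>h F. h \<in> arrows (grp A) \<Longrightarrow> infinite_receiver E (src (grp A) h) \<Longrightarrow>
      finite F \<Longrightarrow> F \<subseteq> {\<mu> \<in> fpaths_at E (src (grp A) h). plength \<mu> = 1} \<Longrightarrow>
      fixes_all_except A h F \<Longrightarrow> h \<in> units (grp A)"
    and q: "(\<alpha>, g, \<beta>, FinPath \<mu>) \<in> quads A"
    and V: "openin (boundary_topology E) V" "FinPath \<mu> \<in> V"
    and iso: "\<And>\<eta>. \<eta> \<in> V \<Longrightarrow> quad_range A (\<alpha>, g, \<beta>, \<eta>) = \<eta>"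
  shows "germ A (\<alpha>, g, \<beta>, FinPath \<mu>) = unit_germ A (FinPath \<mu>)"
proof -
  obtain a as where \<alpha>: "\<alpha> = (a, as)" by force
  obtain b bs where \<beta>: "\<beta> = (b, bs)" by force
  let ?\<xi> = "FinPath \<mu>"
  note q = q [unfolded \<alpha> \<beta>]
  have Q: "(b, bs) \<in> fpaths E" "?\<xi> \<in> boundary_paths E" "?\<xi> \<in> cylinder E (b, bs)"
    using q by (auto simp: quads_def)
  then have xp: "?\<xi> \<in> xpaths E" and b: "xrange E ?\<xi> = b" and pre: "xtake (length bs) ?\<xi> = bs"
    using cylinder_iff [OF Q(1)] by auto
  define cs where "cs = drop (length bs) (snd \<mu>)"
  have "snd \<mu> = bs @ cs" using pre unfolding cs_def by (metis append_take_drop_id xtake.simps(1))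
  then have \<mu>: "\<mu> = (b, bs @ cs)" using b by (simp add: prange_def prod_eq_iff)
  have fpc: "(b, bs @ cs) \<in> fpaths E" using xp unfolding \<mu> xpaths_def by blast
  have \<xi>c: "?\<xi> \<in> cylinder E (b, bs @ cs)"
    using xp b unfolding cylinder_iff [OF fpc] \<mu> by simp
  obtain F where F: "finite F"
    "(cylinder E (b, bs @ cs) - (\<Union>e\<in>F. cylinder E (b, (bs @ cs) @ [e]))) \<inter> boundary_paths E \<subseteq> V"
    using openin_boundary_nhd_finite [OF V [unfolded \<mu>]] by blast
  define as' h where "as' = as @ act_edges A g cs" and "h = res_edges A g cs"
  have q': "((a, as'), h, (b, bs @ cs), ?\<xi>) \<in> quads A"
    unfolding as'_def h_def by (rule quad_shift_quad [OF q fpc \<xi>c])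
  have H: "h \<in> arrows (grp A)" "(a, as') \<in> fpaths E" "rng (grp A) h = psource E (a, as')"
    "src (grp A) h = psource E (b, bs @ cs)"
    using q' unfolding quads_def by auto
  let ?w = "src (grp A) h"
  have w: "?w \<in> verts E" using psource_verts [OF fpc] H(4) by simp
  have iso': "xconcat (a, as') (act_xpath A h \<eta>) = xconcat (b, bs @ cs) \<eta>"
    if \<eta>: "\<eta> \<in> boundary_paths E" "xrange E \<eta> = ?w" "\<And>e. e \<in> F \<Longrightarrow> xtake 1 \<eta> \<noteq> [e]" for \<eta>
  proof -
    have at: "\<eta> \<in> xpaths_at E (psource E (b, bs @ cs))"
      using \<eta> boundary_paths_xpaths H(4) by (auto simp: xpaths_at_def)
    let ?\<zeta> = "xconcat (b, bs @ cs) \<eta>"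
    have \<zeta>: "?\<zeta> \<in> cylinder E (b, bs @ cs)" "?\<zeta> \<in> boundary_paths E"
      using at \<eta>(1) xconcat_boundary_iff [OF fpc at] unfolding cylinder_def by auto
    have "?\<zeta> \<notin> cylinder E (b, (bs @ cs) @ [e])" if e: "e \<in> F" for e
    proof
      assume cyl: "?\<zeta> \<in> cylinder E (b, (bs @ cs) @ [e])"
      then obtain \<theta> where "?\<zeta> = xconcat (b, (bs @ cs) @ [e]) \<theta>" unfolding cylinder_def by blast
      then have "xtake (length (bs @ cs) + 1) ?\<zeta> =
          xtake (length (bs @ cs) + 1) (xconcat (b, (bs @ cs) @ [e]) \<theta>)" by simp
      then have "xtake 1 \<eta> = [e] @ xtake 0 \<theta>" by (simp add: xtake_xconcat)
      then show False using \<eta>(3) [OF e] by (cases \<theta>) auto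
    qed
    then have V: "?\<zeta> \<in> V" using F(2) \<zeta> by blast
    have "?\<zeta> \<in> cylinder E (b, bs)"
      using \<zeta>(1) take_xtake [of "length bs" "length (bs @ cs)" ?\<zeta>]
      unfolding cylinder_iff [OF fpc] cylinder_iff [OF Q(1)] by simp
    then have "((a, as), g, (b, bs), ?\<zeta>) \<in> quads A"
      using q \<zeta>(2) by (simp add: quads_def)
    then have "quad_range A ((a, as'), h, (b, bs @ cs), ?\<zeta>) = ?\<zeta>"
      using quad_range_shift [OF _ fpc \<zeta>(1)] iso [OF V, unfolded \<alpha> \<beta>]
      unfolding as'_def h_def by metis
    then show ?thesis by (simp add: xremainder_xconcat [OF at])
  qed
  have sing: "singular E ?w"
    using Q(2) H(4) unfolding \<mu> boundary_paths_def by auto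
  \<comment> \<open>The vertex is taken as remainder: it begins with no edge of F, and the equation
    compares the prefixes alone.\<close>
  have "xconcat (a, as') (act_xpath A h (FinPath (?w, []))) = xconcat (b, bs @ cs) (FinPath (?w, []))"
    by (rule iso') (use sing w in \<open>auto simp: boundary_paths_def prange_def\<close>)
  then have eq: "a = b" "as' = bs @ cs" by (auto simp: pconcat_def act_path_def)
  then have rng: "rng (grp A) h = ?w" using H(3,4) by simp
  have "h \<in> units (grp A)"
  proof (cases "in_arcs E ?w = {}")
    case True
    \<comment> \<open>The vertex is the only path at s(h), so slack makes it strongly fixed, which
      says that h is this vertex.\<close>
    have nil: "es = []" if "(?w, es) \<in> fpaths E" for es
      using that True by (cases es) (auto simp: in_arcs_def)
    have "\<forall>\<mu>\<in>fpaths_at E ?w. fixes_path A h \<mu>"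
      using rng by (auto simp: fpaths_at_iff fixes_path_iff dest!: nil)
    then have "has_slack A h" using Slack H(1) unfolding cond_Slack_def by blast
    moreover have "(?w, []) \<in> fpaths_at E ?w" using w by (simp add: fpaths_at_iff)
    ultimately obtain \<nu> where "\<nu> \<in> strongly_fixed A h"
      unfolding has_slack_def by blast
    then obtain es where "(?w, es) \<in> strongly_fixed A h" "(?w, es) \<in> fpaths E"
      by (cases \<nu>) (auto simp: strongly_fixed_iff)
    then have "h = ?w" using nil [of es] by (simp add: strongly_fixed_iff)
    then show ?thesis using w units_verts by simp
  next
    case False
    then have inf: "infinite_receiver E ?w" using sing by (simp add: singular_def infinite_receiver_def)
    \<comment> \<open>Edges of F received elsewhere are dropped, so that all members are paths at
      s(h).\<close>
    let ?F = "(\<lambda>e. (?w, [e])) ` (F \<inter> in_arcs E ?w)"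
    have "fixes_path A h (?w, es)" if es: "(?w, es) \<in> fpaths E" "\<forall>\<beta>\<in>?F. \<not> extends E (?w, es) \<beta>" for es
    proof (cases es)
      case Nil
      then show ?thesis using rng by (simp add: fixes_path_iff)
    next
      case (Cons t ts)
      have t: "t \<in> in_arcs E ?w" using es(1) Cons by simp
      have "extends E (?w, es) (?w, [t])" using extends_iff [OF es(1)] Cons by simp
      then have tF: "t \<notin> F" using es(2) t by blast
      obtain \<eta> where \<eta>: "\<eta> \<in> boundary_paths E" "\<eta> \<in> cylinder E (?w, es)"
        using boundary_extension [OF es(1)] by blast
      then have \<eta>x: "xrange E \<eta> = ?w" "xtake (length es) \<eta> = es"
        using cylinder_iff [OF es(1)] by auto
      then have "xtake 1 \<eta> = [t]"
        using take_xtake [of 1 "length es" \<eta>] Cons by simp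
      then have "xconcat (a, as') (act_xpath A h \<eta>) = xconcat (b, bs @ cs) \<eta>"
        using tF by (intro iso' \<eta>(1) \<eta>x(1)) auto
      from arg_cong [OF this, of "xtake (length (bs @ cs) + length es)"]
      have "act_edges A h es = es"
        using eq \<eta>x(2) by (simp add: xtake_xconcat xtake_act_xpath)
      then show ?thesis using rng by (simp add: fixes_path_iff)
    qed
    then have "fixes_all_except A h ?F"
      unfolding fixes_all_except_def by (auto simp: fpaths_at_iff)
    moreover have "finite ?F" using F(1) by simp
    moreover have "?F \<subseteq> {\<mu> \<in> fpaths_at E ?w. plength \<mu> = 1}"
      by (auto simp: fpaths_at_iff plength_def tail_in_verts)
    ultimately show ?thesis using no_exceptional [OF H(1) inf] by blast
  qed
  then have "h = ?w" using src_unit by simp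
  \<comment> \<open>The empty extension serves in the unit criterion, because h is already a
    vertex.\<close>
  then have "germ A ((a, as'), h, (b, bs @ cs), ?\<xi>) = unit_germ A ?\<xi>"
    unfolding germ_eq_unit_germ_iff [OF q'] using eq fpc \<xi>c H(4)
    by (intro exI [of _ "[]"]) simp
  then show ?thesis
    using germ_quad_shift [OF q fpc \<xi>c] unfolding \<alpha> \<beta> as'_def h_def by simp
qed

end

theorem theorem6p28:
  fixes A :: "('g, 'e) ssa"
  assumes "self_similar_action A"
  shows "effective (tight_groupoid A) \<longleftrightarrow>
    cond_Cyc A \<and> cond_Slack A \<and>
    \<not> (\<exists>g \<in> arrows (grp A) - units (grp A).
         infinite_receiver (gra A) (src (grp A) g) \<and>
         (\<exists>F. finite F \<and> F \<subseteq> {\<mu> \<in> fpaths_at (gra A) (src (grp A) g). plength \<mu> = 1} \<and>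
              fixes_all_except A g F))"
  (is "_ \<longleftrightarrow> _ \<and> _ \<and> \<not> ?exceptional")
proof -
  interpret self_similar_action A by fact
  show ?thesis
  proof (intro iffI conjI)
    assume eff: "effective (tight_groupoid A)"
    show "cond_Cyc A" using eff by (rule effective_imp_Cyc)
    show "cond_Slack A" using effective_imp_slack [OF eff] unfolding cond_Slack_def by blast
    show "\<not> ?exceptional" using effective_imp_no_exceptional [OF eff] by blast
  next
    assume *: "cond_Cyc A \<and> cond_Slack A \<and> \<not> ?exceptional"
    then have no_exceptional: "h \<in> units (grp A)"
      if "h \<in> arrows (grp A)" "infinite_receiver (gra A) (src (grp A) h)" "finite F"
        "F \<subseteq> {\<mu> \<in> fpaths_at (gra A) (src (grp A) h). plength \<mu> = 1}" "fixes_all_except A h F"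
      for h F
      using that by blast
    have Cyc: "cond_Cyc A" and Slack: "cond_Slack A" using * by blast+
    show "effective (tight_groupoid A)"
      unfolding effective_iff
    proof (intro allI impI)
      fix \<alpha> g \<beta> \<xi> V
      assume q: "(\<alpha>, g, \<beta>, \<xi>) \<in> quads A" and V: "openin (boundary_topology (gra A)) V" "\<xi> \<in> V"
        and iso: "\<forall>\<eta>\<in>V. quad_range A (\<alpha>, g, \<beta>, \<eta>) = \<eta>"
      show "germ A (\<alpha>, g, \<beta>, \<xi>) = unit_germ A \<xi>"
      proof (cases \<xi>)
        case (FinPath \<mu>)
        show ?thesis
          using unit_of_finite [OF Slack no_exceptional q [unfolded FinPath] V [unfolded FinPath]
              bspec [OF iso]]
          unfolding FinPath .
      next
        case (InfPath x)
        show ?thesis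
          using unit_of_infinite [OF Cyc Slack q [unfolded InfPath] V [unfolded InfPath]
              bspec [OF iso]]
          unfolding InfPath .
      qed
    qed
  qed
qed

end
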